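(* Let $I=(u_1,\ldots,u_r)$ be a monomial ideal of $S=\Bbbk[x_1,\ldots,x_n]$, generated by monomials $u_1,\ldots,u_r$, and let $\mathbf{a}_\ell=\deg_{\mathbb{Z}^n}(u_\ell)$ for all $\ell\in\{1,\ldots,r\}$. For any $\ell\in\{1,\ldots,r\}$, $i\in\mathbb{N}$ and $\mathbf{a}\in\mathbb{Z}^n$: \[ \beta_{i,\mathbf{b}}(S/I)=0 \ \text{ for all } \mathbf{b}\in\mathbb{Z}^n \text{ with } \mathbf{a}\le \mathbf{b}<\mathbf{a}+\mathbf{a}_\ell \quad\Longrightarrow\quad \beta_{i+1,\mathbf{a}+\mathbf{a}_\ell}(S/I)=0 . \] In particular, if $d=\max_{\ell}\{\deg_{\mathbb{Z}}(u_\ell)\}$, then for any $i\in\mathbb{N}$ and any $j\in\mathbb{Z}$: \[ \beta_{i,k}(S/I)=0 \ \text{ for all } k=j,\ldots,j+d-1 \quad\Longrightarrow\quad \beta_{i+1,j+d}(S/I)=0 . \]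
   Context: $\Bbbk$ is a field, $S=\Bbbk[x_1,\ldots,x_n]$ is the polynomial ring in $n$ variables, and $\mathbb{N}=\{0,1,2,\ldots\}$. For $\mathbf{a}=(a_1,\ldots,a_n)$ and $\mathbf{b}=(b_1,\ldots,b_n)$ in $\mathbb{Z}^n$, $\mathbf{a}\le\mathbf{b}$ means $a_i\le b_i$ for all $i\in\{1,\ldots,n\}$, and $\mathbf{a}<\mathbf{b}$ means $\mathbf{a}\le\mathbf{b}$ and $\mathbf{a}\ne\mathbf{b}$. The ring $S$ carries its standard $\mathbb{Z}^n$-grading ($x_i$ in degree the $i$-th unit vector) and its standard $\mathbb{Z}$-grading ($\deg x_i=1$); $\deg_{\mathbb{Z}^n}(u)$ is the exponent vector of a monomial $u$ and $\deg_{\mathbb{Z}}(u)$ its total degree. The multigraded Betti number is $\beta_{i,\mathbf{b}}(S/I)=\dim_\Bbbk \mathrm{Tor}_i^S(S/I,\Bbbk)_{\mathbf{b}}$ for $\mathbf{b}\in\mathbb{Z}^n$, and the graded Betti number is $\beta_{i,k}(S/I)=\dim_\Bbbk \mathrm{Tor}_i^S(S/I,\Bbbk)_k$ for $k\in\mathbb{Z}$; equivalently, these are the numbers of generators of the corresponding degree in homological position $i$ of the minimal ($\mathbb{Z}^n$-graded, respectively $\mathbb{Z}$-graded) free resolution of $S/I$ over $S$.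
   Formalization: The first assertion is stated only for a ≥ 0 (a in N^n) instead of all a in Z^n; for arbitrary a it fails, e.g. I=(xy^3, y^7), a_l=(1,3), i=0, a=(-1,4), where β_{1,(0,7)}(S/I)=1. The second assertion is unchanged. *)

theory Defs
  imports
    "HOL-Analysis.Analysis"
    "HOL-Library.Poly_Mapping"
    "HOL-Library.Function_Algebras"
begin

text \<open>
  The polynomial ring \<open>S\<close> over the field \<open>'k\<close>, with variables indexed by the finite type \<open>'n\<close>:
  finitely supported functions from exponent vectors to coefficients, with the convolution product
  of \<^theory>\<open>HOL-Library.Poly_Mapping\<close>.
\<close>

type_synonym ('k, 'n) mpoly = "(nat ^ 'n) \<Rightarrow>\<^sub>0 'k"

definition xmonom :: "nat ^ 'n \<Rightarrow> ('k::field, 'n::finite) mpoly" where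
  "xmonom m = Poly_Mapping.single m 1"

definition zdeg :: "nat ^ 'n \<Rightarrow> int ^ 'n" where
  "zdeg m = (\<chi> j. int (m $ j))"

definition tdeg :: "int ^ 'n \<Rightarrow> int" where
  "tdeg b = (\<Sum>j\<in>UNIV. b $ j)"

definition homogeneous :: "int ^ 'n \<Rightarrow> ('k::field, 'n::finite) mpoly \<Rightarrow> bool" where
  "homogeneous b f \<longleftrightarrow> (\<forall>m \<in> Poly_Mapping.keys f. zdeg m = b)"

definition ideal_of :: "('k::field, 'n::finite) mpoly set \<Rightarrow> ('k, 'n) mpoly set" where
  "ideal_of U = module.span (*) U"

text \<open>
  A sequence of finitely generated \<open>\<int>\<^sup>n\<close>-graded free \<open>S\<close>-modules with augmentation. The module \<open>F\<^sub>i\<close>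
  has the basis \<open>e\<^sub>0, \<dots>, e\<^bsub>rk i - 1\<^esub>\<close> with \<open>e\<^sub>q\<close> in degree \<open>bdeg i q\<close>; an element of \<open>F\<^sub>i\<close> is its
  coordinate function, which vanishes from \<open>rk i\<close> on. The differential
  \<open>F\<^bsub>i+1\<^esub> \<rightarrow> F\<^sub>i\<close> sends \<open>e\<^sub>q\<close> to the sum of the \<open>dmat i p q * e\<^sub>p\<close>, and the augmentation
  \<open>F\<^sub>0 \<rightarrow> S/I\<close> sends \<open>e\<^sub>q\<close> to the class of \<open>aug q\<close>.
\<close>

record (overloaded) ('k, 'n) free_complex =
  rk :: "nat \<Rightarrow> nat"
  bdeg :: "nat \<Rightarrow> nat \<Rightarrow> int ^ 'n"
  dmat :: "nat \<Rightarrow> nat \<Rightarrow> nat \<Rightarrow> (nat ^ 'n) \<Rightarrow>\<^sub>0 'k"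
  aug :: "nat \<Rightarrow> (nat ^ 'n) \<Rightarrow>\<^sub>0 'k"

definition coord_vectors :: "nat \<Rightarrow> (nat \<Rightarrow> 'r::zero) set" where
  "coord_vectors r = {v. \<forall>q\<ge>r. v q = 0}"

definition mat_app :: "nat \<Rightarrow> nat \<Rightarrow> (nat \<Rightarrow> nat \<Rightarrow> 'r::comm_ring_1) \<Rightarrow> (nat \<Rightarrow> 'r) \<Rightarrow> nat \<Rightarrow> 'r" where
  "mat_app r s A v = (\<lambda>p. if p < r then \<Sum>q<s. A p q * v q else 0)"

definition free_mod :: "('k::field, 'n::finite) free_complex \<Rightarrow> nat \<Rightarrow> (nat \<Rightarrow> ('k, 'n) mpoly) set" where
  "free_mod F i = coord_vectors (rk F i)"

definition diff_map ::
    "('k::field, 'n::finite) free_complex \<Rightarrow> nat \<Rightarrow> (nat \<Rightarrow> ('k, 'n) mpoly) \<Rightarrow> nat \<Rightarrow> ('k, 'n) mpoly" where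
  "diff_map F i = mat_app (rk F i) (rk F (Suc i)) (dmat F i)"

definition aug_map ::
    "('k::field, 'n::finite) free_complex \<Rightarrow> (nat \<Rightarrow> ('k, 'n) mpoly) \<Rightarrow> ('k, 'n) mpoly" where
  "aug_map F v = (\<Sum>q<rk F 0. aug F q * v q)"

text \<open>\<open>F\<close> is a \<open>\<int>\<^sup>n\<close>-graded free resolution of \<open>S/I\<close>: all maps are homogeneous of degree \<open>0\<close>, and
  \<open>\<dots> \<rightarrow> F\<^sub>1 \<rightarrow> F\<^sub>0 \<rightarrow> S/I \<rightarrow> 0\<close> is exact.\<close>

definition graded_resolution ::
    "('k::field, 'n::finite) mpoly set \<Rightarrow> ('k, 'n) free_complex \<Rightarrow> bool" where
  "graded_resolution I F \<longleftrightarrow>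
     (\<forall>q<rk F 0. homogeneous (bdeg F 0 q) (aug F q)) \<and>
     (\<forall>i. \<forall>p<rk F i. \<forall>q<rk F (Suc i). homogeneous (bdeg F (Suc i) q - bdeg F i p) (dmat F i p q)) \<and>
     (\<forall>f. \<exists>v\<in>free_mod F 0. f - aug_map F v \<in> I) \<and>
     {v \<in> free_mod F 0. aug_map F v \<in> I} = diff_map F 0 ` free_mod F 1 \<and>
     (\<forall>i. {v \<in> free_mod F (Suc i). diff_map F i v = 0} = diff_map F (Suc i) ` free_mod F (Suc (Suc i)))"

text \<open>
  The complex \<open>F \<otimes>\<^sub>S \<bbbk>\<close>, where \<open>\<bbbk> = S/(x\<^sub>1, \<dots>, x\<^sub>n)\<close>: the vector space \<open>F\<^sub>i \<otimes>\<^sub>S \<bbbk>\<close> has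
  the basis \<open>e\<^sub>q \<otimes> 1\<close> for \<open>q < rk i\<close>, and the matrices of the differentials are reduced modulo
  \<open>(x\<^sub>1, \<dots>, x\<^sub>n)\<close>, that is, to their constant coefficients.
\<close>

definition tensor_diff ::
    "('k::field, 'n::finite) free_complex \<Rightarrow> nat \<Rightarrow> (nat \<Rightarrow> 'k) \<Rightarrow> nat \<Rightarrow> 'k" where
  "tensor_diff F i = mat_app (rk F i) (rk F (Suc i)) (\<lambda>p q. Poly_Mapping.lookup (dmat F i p q) 0)"

definition tor_cycles :: "('k::field, 'n::finite) free_complex \<Rightarrow> nat \<Rightarrow> (nat \<Rightarrow> 'k) set" where
  "tor_cycles F i =
     {w \<in> coord_vectors (rk F i). case i of 0 \<Rightarrow> True | Suc i' \<Rightarrow> tensor_diff F i' w = 0}"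

definition tor_boundaries :: "('k::field, 'n::finite) free_complex \<Rightarrow> nat \<Rightarrow> (nat \<Rightarrow> 'k) set" where
  "tor_boundaries F i = tensor_diff F i ` coord_vectors (rk F (Suc i))"

text \<open>The part of \<open>F\<^sub>i \<otimes>\<^sub>S \<bbbk>\<close> spanned by its homogeneous elements with degree in \<open>D\<close>.\<close>

definition tensor_part ::
    "('k::field, 'n::finite) free_complex \<Rightarrow> nat \<Rightarrow> (int ^ 'n) set \<Rightarrow> (nat \<Rightarrow> 'k) set" where
  "tensor_part F i D = {w \<in> coord_vectors (rk F i). \<forall>q<rk F i. w q \<noteq> 0 \<longrightarrow> bdeg F i q \<in> D}"

definition kdim :: "(nat \<Rightarrow> 'k::field) set \<Rightarrow> nat" where
  "kdim V = vector_space.dim (\<lambda>c w q. c * w q) V"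

text \<open>
  The dimension of the part of \<open>Tor\<^sub>i(S/I, \<bbbk>) = H\<^sub>i(F \<otimes>\<^sub>S \<bbbk>)\<close> with degrees in \<open>D\<close>. As the boundaries
  are contained in the cycles and all spaces are finite-dimensional, the dimension of the quotient is
  the difference of the dimensions.
\<close>

definition tor_dim :: "('k::field, 'n::finite) free_complex \<Rightarrow> nat \<Rightarrow> (int ^ 'n) set \<Rightarrow> nat" where
  "tor_dim F i D = kdim (tor_cycles F i \<inter> tensor_part F i D) - kdim (tor_boundaries F i \<inter> tensor_part F i D)"

text \<open>
  \<open>Tor\<close> does not depend on the chosen resolution. A \<open>\<int>\<^sup>n\<close>-graded free resolution is also
  \<open>\<int>\<close>-graded by total degree, so the component of \<open>Tor\<close> in \<open>\<int>\<close>-degree \<open>k\<close> collects the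
  \<open>\<int>\<^sup>n\<close>-degrees of total degree \<open>k\<close>.
\<close>

definition tor_resolution :: "('k::field, 'n::finite) mpoly set \<Rightarrow> ('k, 'n) free_complex" where
  "tor_resolution I = (SOME F. graded_resolution I F)"

definition multigraded_betti :: "('k::field, 'n::finite) mpoly set \<Rightarrow> nat \<Rightarrow> int ^ 'n \<Rightarrow> nat" where
  "multigraded_betti I i b = tor_dim (tor_resolution I) i {b}"

definition graded_betti :: "('k::field, 'n::finite) mpoly set \<Rightarrow> nat \<Rightarrow> int \<Rightarrow> nat" where
  "graded_betti I i k = tor_dim (tor_resolution I) i {b. tdeg b = k}"

text \<open>
  A pitfall in stating vanishing results of the form "\<open>\<beta>\<^sub>i\<close> vanishes in all degrees \<open>b\<close> with
  \<open>a \<le> b < a + a\<^sub>l\<close>, hence \<open>\<beta>\<^bsub>i+1\<^esub>\<close> vanishes in degree \<open>a + a\<^sub>l\<close>", where \<open>a\<^sub>l\<close> is the degree of a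
  monomial generator of \<open>I\<close>: they need \<open>0 \<le> a\<close>. For \<open>I = (x y\<^sup>3, y\<^sup>7)\<close>, \<open>a\<^sub>l = (1, 3)\<close>, \<open>i = 0\<close> and
  \<open>a = (-1, 4)\<close>, the only degree \<open>b\<close> with \<open>\<beta>\<^bsub>0,b\<^esub>(S/I) \<noteq> 0\<close> is \<open>0\<close>, and \<open>0\<close> is not above \<open>a\<close>, but the
  minimal generator \<open>y\<^sup>7\<close> gives \<open>\<beta>\<^bsub>1,(0,7)\<^esub>(S/I) = 1\<close>.
\<close>

lemma module_mult: "module ((*) :: 'r::comm_ring_1 \<Rightarrow> 'r \<Rightarrow> 'r)"
  by unfold_locales (simp_all add: algebra_simps)

lemma vector_space_pointwise:
  "vector_space (\<lambda>(c::'k::field) (w :: nat \<Rightarrow> 'k) q. c * w q)"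
  by unfold_locales (auto simp: fun_eq_iff algebra_simps)

end

theory Submission
  imports Defs
begin

text \<open>
  Let \<open>F\<close> be a multigraded free resolution of \<open>S/I\<close>. A homogeneous map between graded free modules is
  a matrix of scalars times monomials that the degrees dictate, so setting all variables to \<open>1\<close> loses
  nothing: \<open>F\<close> becomes a complex of finite-dimensional vector spaces whose basis vectors carry degrees,
  and the component of \<open>F\<close> in degree \<open>b\<close> (its \<^emph>\<open>strand\<close>) becomes the subcomplex spanned by the basis
  vectors of degree \<open>\<le> b\<close>. A strand is exact in all positive positions, and in position \<open>0\<close> as well
  if \<open>x\<^sup>b \<in> I\<close>. \<open>Tor\<^sub>i\<close> in degree \<open>b\<close> is the homology of the strand at \<open>b\<close> modulo the basis vectors
  of degree \<open>< b\<close>.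

  Let \<open>\<alpha>\<close> be the degree of a generator and let \<open>f b\<close> be the componentwise maximum of \<open>b\<close> and \<open>\<alpha>\<close>.
  Multiplication by a generator is zero on \<open>S/I\<close> and hence null-homotopic on \<open>F\<close>. The proof rests on a
  sharper form of this: all strands at the degrees \<open>f b\<close> are exact, hence they have a common
  contraction, which sends a basis vector of degree \<open>b\<close> into the strand at \<open>f b\<close>, and not merely into
  the strand at \<open>b + \<alpha>\<close> (lemma \<open>exists_contraction\<close>).

  Now let \<open>c = a + \<alpha>\<close> with \<open>a \<ge> 0\<close>, so that \<open>f c = c\<close>, and let \<open>z\<close> in position \<open>i + 1\<close> and degree \<open>c\<close>
  represent a class of \<open>Tor\<close>. Its differential \<open>y\<close> lives in degrees \<open>b < c\<close>. Those \<open>b \<ge> 0\<close> with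
  \<open>f b = c\<close> satisfy \<open>a \<le> b\<close>, so \<open>Tor\<^sub>i\<close> vanishes there by hypothesis; it always vanishes in
  degrees with a negative entry. So the components of \<open>y\<close> in all degrees \<open>b\<close> with \<open>f b = c\<close> can be removed, from the top down, by subtracting differentials of vectors of degrees \<open>< c\<close> (lemma
  \<open>push_to_lower_degrees\<close>). On the other components \<open>f b < c\<close>, so the contraction shows that \<open>y\<close> is
  the differential of some \<open>w\<close> of degrees \<open>< c\<close>. Then \<open>z - w\<close> is a cycle in the exact strand at \<open>c\<close>,
  and so \<open>z\<close> is a boundary modulo degrees \<open>< c\<close> (lemma \<open>tor_vanishing_step\<close>).

  For the statement on total degrees, a degree \<open>c\<close> above the degree \<open>\<alpha>\<close> of some generator is
  \<open>a + \<alpha>\<close> with \<open>a = c - \<alpha> \<ge> 0\<close>, and all \<open>b\<close> with \<open>a \<le> b < c\<close> have total degree in the prescribed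
  range. In the remaining degrees \<open>c\<close> the ideal \<open>I\<close> has no component, the strand at \<open>c\<close> resolves the
  degree-\<open>c\<close> component of \<open>S\<close>, and \<open>Tor\<close> vanishes in positive positions by the same argument with the identity
  for \<open>f\<close>.

  Betti numbers are read off from a resolution that is merely chosen, so the existence of one has to be
  shown. The chosen one may be far from minimal; this is why the argument speaks of cycles and boundaries
  modulo lower degrees instead of minimal generators.
\<close>

section \<open>Homogeneous terms and coefficients\<close>

definition nat_exponent :: "int ^ 'n \<Rightarrow> nat ^ 'n" where
  "nat_exponent e = (\<chi> j. nat (e $ j))"

text \<open>
  The indexing by integer vectors, with value \<open>0\<close> outside the nonnegative ones, lets degrees be
  subtracted freely: the monomial that joins two basis elements is \<open>zterm\<close> of the difference of their
  degrees whether or not this difference is an exponent vector.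
\<close>

definition zterm :: "int ^ 'n \<Rightarrow> 'k \<Rightarrow> ('k::field, 'n::finite) mpoly" where
  "zterm e c = (if 0 \<le> e then Poly_Mapping.single (nat_exponent e) c else 0)"

definition zcoeff :: "int ^ 'n \<Rightarrow> ('k::field, 'n::finite) mpoly \<Rightarrow> 'k" where
  "zcoeff e f = (if 0 \<le> e then Poly_Mapping.lookup f (nat_exponent e) else 0)"

lemma zdeg_nonneg: "0 \<le> zdeg m"
  by (simp add: less_eq_vec_def zdeg_def)

lemma zdeg_nat_exponent: "0 \<le> e \<Longrightarrow> zdeg (nat_exponent e) = e"
  by (simp add: less_eq_vec_def zdeg_def nat_exponent_def vec_eq_iff)

lemma nat_exponent_zdeg: "nat_exponent (zdeg m) = m"
  by (simp add: zdeg_def nat_exponent_def vec_eq_iff)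

lemma zdeg_eq_iff: "zdeg m = e \<longleftrightarrow> 0 \<le> e \<and> m = nat_exponent e"
  using zdeg_nonneg zdeg_nat_exponent nat_exponent_zdeg by metis

lemma nat_exponent_add:
  "0 \<le> e \<Longrightarrow> 0 \<le> e' \<Longrightarrow> nat_exponent (e + e') = nat_exponent e + nat_exponent e'"
  by (simp add: less_eq_vec_def nat_exponent_def vec_eq_iff nat_add_distrib)

lemma vec_add_nonneg: "0 \<le> e \<Longrightarrow> 0 \<le> e' \<Longrightarrow> 0 \<le> e + (e' :: int ^ 'n)"
  by (simp add: less_eq_vec_def)

lemma vec_diff_nonneg_iff: "0 \<le> e - e' \<longleftrightarrow> e' \<le> (e :: int ^ 'n)"
  by (simp add: less_eq_vec_def)

lemma zcoeff_zero [simp]: "zcoeff e 0 = 0"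
  and zcoeff_diff: "zcoeff e (f - g) = zcoeff e f - zcoeff e g"
  by (simp_all add: zcoeff_def lookup_add lookup_minus)

lemma zcoeff_sum: "zcoeff e (\<Sum>x\<in>X. f x) = (\<Sum>x\<in>X. zcoeff e (f x))"
  by (simp add: zcoeff_def lookup_sum)

lemma zterm_zero [simp]: "zterm e 0 = 0"
  and zterm_add: "zterm e (c + c') = zterm e c + zterm e c'"
  by (simp_all add: zterm_def single_add)

lemma zterm_sum: "zterm e (\<Sum>x\<in>X. f x) = (\<Sum>x\<in>X. zterm e (f x))"
  by (induction X rule: infinite_finite_induct) (simp_all add: zterm_add)

lemma zcoeff_zterm: "zcoeff e (zterm e' c) = (if e = e' \<and> 0 \<le> e then c else 0)"
  by (auto simp: zcoeff_def zterm_def lookup_single when_def) (metis zdeg_nat_exponent)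

lemma zterm_mult_zterm:
  "0 \<le> e \<Longrightarrow> 0 \<le> e' \<Longrightarrow> zterm e c * zterm e' c' = zterm (e + e') (c * c')"
  by (simp add: zterm_def vec_add_nonneg nat_exponent_add mult_single)

lemma zterm_zero_one: "zterm 0 1 = 1"
proof -
  have "nat_exponent 0 = (0 :: nat ^ 'a)" by (simp add: nat_exponent_def vec_eq_iff)
  then show ?thesis by (simp add: zterm_def)
qed

lemma xmonom_eq_zterm: "xmonom m = zterm (zdeg m) 1"
  by (simp add: xmonom_def zterm_def zdeg_nonneg nat_exponent_zdeg)

lemma lookup_single_mult:
  fixes g :: "('k::field, 'n::finite) mpoly"
  shows "Poly_Mapping.lookup (Poly_Mapping.single m c * g) k =
    (if \<exists>q. k = m + q then c * Poly_Mapping.lookup g (k - m) else 0)"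
proof -
  have "Poly_Mapping.lookup (Poly_Mapping.single m c * g) k =
      (\<Sum>l. (c * (\<Sum>q. Poly_Mapping.lookup g q when k = l + q)) when m = l)"
    by (simp add: lookup_mult lookup_single when_mult)
  also have "\<dots> = c * (\<Sum>q. Poly_Mapping.lookup g q when k = m + q)"
    by simp
  also have "\<dots> = (if \<exists>q. k = m + q then c * Poly_Mapping.lookup g (k - m) else 0)"
  proof (cases "\<exists>q. k = m + q")
    case True
    then obtain q where q: "k = m + q" by blast
    have "(Poly_Mapping.lookup g q' when k = m + q') = (Poly_Mapping.lookup g q' when q' = q)" for q'
      using q by (simp add: when_def)
    moreover have "k - m = q" using q by (simp add: vec_eq_iff)
    ultimately show ?thesis using True by simp
  next
    case False
    then have "(Poly_Mapping.lookup g q when k = m + q) = 0" for q by (simp add: when_def)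
    then show ?thesis using False by simp
  qed
  finally show ?thesis .
qed

lemma zcoeff_zterm_mult:
  "zcoeff e (zterm e' c * g) = (if 0 \<le> e' then c * zcoeff (e - e') g else 0)"
proof (cases "0 \<le> e' \<and> 0 \<le> e")
  case True
  have "(\<exists>q. nat_exponent e = nat_exponent e' + q) \<longleftrightarrow> 0 \<le> e - e'"
  proof
    assume "\<exists>q. nat_exponent e = nat_exponent e' + q"
    then obtain q where q: "nat_exponent e = nat_exponent e' + q" by blast
    have "e' $ j \<le> e $ j" for j
    proof -
      have "nat (e $ j) = nat (e' $ j) + q $ j"
        using arg_cong[OF q, of "\<lambda>x. x $ j"] by (simp add: nat_exponent_def)
      moreover have "0 \<le> e $ j" "0 \<le> e' $ j" using True by (simp_all add: less_eq_vec_def)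
      ultimately show ?thesis by linarith
    qed
    then show "0 \<le> e - e'" by (simp add: less_eq_vec_def)
  next
    assume "0 \<le> e - e'"
    then have "nat_exponent e = nat_exponent e' + nat_exponent (e - e')"
      using True nat_exponent_add[of e' "e - e'"] by simp
    then show "\<exists>q. nat_exponent e = nat_exponent e' + q" by blast
  qed
  moreover have "nat_exponent e - nat_exponent e' = nat_exponent (e - e')" if "0 \<le> e - e'"
    using nat_exponent_add[of e' "e - e'"] True that by (simp add: vec_eq_iff)
  ultimately show ?thesis
    using True by (auto simp: zcoeff_def zterm_def lookup_single_mult)
next
  case False
  moreover have "\<not> 0 \<le> e - e'" if "0 \<le> e'" "\<not> 0 \<le> e"
    using that vec_diff_nonneg_iff order_trans by blast
  ultimately show ?thesis by (auto simp: zcoeff_def zterm_def)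
qed

lemma homogeneous_zterm: "homogeneous e (zterm e c)"
  by (simp add: homogeneous_def zterm_def zdeg_nat_exponent)

lemma homogeneous_eq_zterm:
  assumes "homogeneous e f"
  shows "f = zterm e (zcoeff e f)"
proof (rule poly_mapping_eqI)
  fix m
  show "Poly_Mapping.lookup f m = Poly_Mapping.lookup (zterm e (zcoeff e f)) m"
  proof (cases "zdeg m = e")
    case True
    then show ?thesis by (auto simp: zdeg_eq_iff zterm_def zcoeff_def)
  next
    case False
    then have "m \<notin> Poly_Mapping.keys f" using assms by (auto simp: homogeneous_def)
    then show ?thesis using False
      by (auto simp: in_keys_iff zterm_def lookup_single when_def zdeg_nat_exponent)
  qed
qed

lemma mpoly_eq_sum_zterms:
  assumes "finite E" "zdeg ` Poly_Mapping.keys f \<subseteq> E"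
  shows "f = (\<Sum>e\<in>E. zterm e (zcoeff e f))"
proof (rule poly_mapping_eqI)
  fix m
  have "Poly_Mapping.lookup (zterm e (zcoeff e f)) m
      = (if e = zdeg m then Poly_Mapping.lookup f m else 0)" for e
    by (auto simp: zterm_def zcoeff_def lookup_single when_def zdeg_nonneg nat_exponent_zdeg
        zdeg_nat_exponent)
  then have "Poly_Mapping.lookup (\<Sum>e\<in>E. zterm e (zcoeff e f)) m
      = (if zdeg m \<in> E then Poly_Mapping.lookup f m else 0)"
    using assms(1) by (simp add: lookup_sum)
  then show "Poly_Mapping.lookup f m = Poly_Mapping.lookup (\<Sum>e\<in>E. zterm e (zcoeff e f)) m"
    using assms(2) by (cases "m \<in> Poly_Mapping.keys f") (auto simp: in_keys_iff)
qed

section \<open>Homogeneous matrices and their strands\<close>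

lemma mat_app_in_coord_vectors: "mat_app s t A v \<in> coord_vectors s"
  by (simp add: mat_app_def coord_vectors_def)

lemma mat_app_add: "mat_app s t A (v + w) = mat_app s t A v + mat_app s t A w"
  by (auto simp: mat_app_def fun_eq_iff algebra_simps sum.distrib)

lemma mat_app_diff: "mat_app s t A (v - w) = mat_app s t A v - mat_app s t A w"
  by (auto simp: mat_app_def fun_eq_iff algebra_simps sum_subtractf)

lemma mat_app_zero [simp]: "mat_app s t A 0 = 0"
  by (auto simp: mat_app_def fun_eq_iff)

lemma mat_app_sum: "mat_app s t A (\<Sum>x\<in>X. v x) = (\<Sum>x\<in>X. mat_app s t A (v x))"
  using sum_comp_morphism[of "mat_app s t A" v X] by (simp only: mat_app_zero mat_app_add comp_def)

text \<open>
  The analogue of \<^const>\<open>tensor_part\<close> for a free module that is given by its rank and the degrees of its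
  basis, without an ambient complex.
\<close>

definition graded_part :: "nat \<Rightarrow> (nat \<Rightarrow> int ^ 'n) \<Rightarrow> (int ^ 'n) set \<Rightarrow> (nat \<Rightarrow> 'k::zero) set" where
  "graded_part r \<beta> D = {w \<in> coord_vectors r. \<forall>q<r. w q \<noteq> 0 \<longrightarrow> \<beta> q \<in> D}"

text \<open>
  The matrix \<open>A\<close> with all variables set to \<open>1\<close>, provided that \<open>A\<close> is homogeneous for the degrees
  \<open>\<beta>\<close> of the target basis and \<open>\<gamma>\<close> of the source basis.
\<close>

definition strand_matrix :: "(nat \<Rightarrow> int ^ 'n) \<Rightarrow> (nat \<Rightarrow> int ^ 'n) \<Rightarrow>
    (nat \<Rightarrow> nat \<Rightarrow> ('k::field, 'n::finite) mpoly) \<Rightarrow> nat \<Rightarrow> nat \<Rightarrow> 'k" where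
  "strand_matrix \<beta> \<gamma> A p q = zcoeff (\<gamma> q - \<beta> p) (A p q)"

text \<open>
  Passing between the degree-\<open>b\<close> component of a graded free module and the coefficient vectors
  supported on the basis elements of degree \<open>\<le> b\<close>.
\<close>

definition homogenize :: "int ^ 'n \<Rightarrow> (nat \<Rightarrow> int ^ 'n) \<Rightarrow> (nat \<Rightarrow> 'k) \<Rightarrow>
    nat \<Rightarrow> ('k::field, 'n::finite) mpoly" where
  "homogenize b \<beta> z q = zterm (b - \<beta> q) (z q)"

definition strand :: "int ^ 'n \<Rightarrow> (nat \<Rightarrow> int ^ 'n) \<Rightarrow> (nat \<Rightarrow> ('k::field, 'n::finite) mpoly) \<Rightarrow>
    nat \<Rightarrow> 'k" where
  "strand b \<beta> v q = zcoeff (b - \<beta> q) (v q)"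

definition homogeneous_matrix :: "nat \<Rightarrow> (nat \<Rightarrow> int ^ 'n) \<Rightarrow> nat \<Rightarrow> (nat \<Rightarrow> int ^ 'n) \<Rightarrow>
    (nat \<Rightarrow> nat \<Rightarrow> ('k::field, 'n::finite) mpoly) \<Rightarrow> bool" where
  "homogeneous_matrix s \<beta> t \<gamma> A \<longleftrightarrow> (\<forall>p<s. \<forall>q<t. homogeneous (\<gamma> q - \<beta> p) (A p q))"

lemma homogeneous_matrix_entry:
  assumes "homogeneous_matrix s \<beta> t \<gamma> A" "p < s" "q < t"
  shows "A p q = zterm (\<gamma> q - \<beta> p) (strand_matrix \<beta> \<gamma> A p q)"
  using assms homogeneous_eq_zterm by (auto simp: homogeneous_matrix_def strand_matrix_def)

lemma strand_matrix_eq_0: "\<not> \<beta> p \<le> \<gamma> q \<Longrightarrow> strand_matrix \<beta> \<gamma> A p q = 0"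
  by (simp add: strand_matrix_def zcoeff_def vec_diff_nonneg_iff)

lemma homogenize_zero [simp]: "homogenize b \<beta> 0 = 0"
  by (simp add: homogenize_def fun_eq_iff)

lemma strand_zero [simp]: "strand b \<beta> 0 = 0"
  by (simp add: strand_def fun_eq_iff)

lemma homogenize_in_coord_vectors: "z \<in> coord_vectors r \<Longrightarrow> homogenize b \<beta> z \<in> coord_vectors r"
  by (simp add: homogenize_def coord_vectors_def)

lemma strand_in_graded_part: "v \<in> coord_vectors r \<Longrightarrow> strand b \<beta> v \<in> graded_part r \<beta> {..b}"
  by (auto simp: graded_part_def strand_def coord_vectors_def zcoeff_def vec_diff_nonneg_iff)

lemma strand_homogenize:
  "z \<in> graded_part r \<beta> {..b} \<Longrightarrow> strand b \<beta> (homogenize b \<beta> z) = z"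
  unfolding fun_eq_iff
proof
  fix q assume z: "z \<in> graded_part r \<beta> {..b}"
  show "strand b \<beta> (homogenize b \<beta> z) q = z q"
    using z by (cases "q < r")
      (auto simp: strand_def homogenize_def zcoeff_zterm graded_part_def coord_vectors_def
        vec_diff_nonneg_iff)
qed

lemma strand_mat_app:
  assumes A: "homogeneous_matrix s \<beta> t \<gamma> A"
  shows "strand b \<beta> (mat_app s t A v) = mat_app s t (strand_matrix \<beta> \<gamma> A) (strand b \<gamma> v)"
proof
  fix p
  have "zcoeff (b - \<beta> p) (A p q * v q) = strand_matrix \<beta> \<gamma> A p q * zcoeff (b - \<gamma> q) (v q)"
    if "p < s" "q < t" for q
  proof -
    have "zcoeff (b - \<beta> p) (A p q * v q)
        = zcoeff (b - \<beta> p) (zterm (\<gamma> q - \<beta> p) (strand_matrix \<beta> \<gamma> A p q) * v q)"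
      using homogeneous_matrix_entry[OF A that] by simp
    also have "\<dots> = strand_matrix \<beta> \<gamma> A p q * zcoeff (b - \<gamma> q) (v q)"
      using strand_matrix_eq_0[of \<beta> p \<gamma> q A] by (simp add: zcoeff_zterm_mult vec_diff_nonneg_iff)
    finally show ?thesis .
  qed
  then show "strand b \<beta> (mat_app s t A v) p
      = mat_app s t (strand_matrix \<beta> \<gamma> A) (strand b \<gamma> v) p"
    by (simp add: strand_def mat_app_def zcoeff_sum)
qed

text \<open>
  The vector has to be supported in degrees \<open>\<le> b\<close>: an entry in any other degree is lost by
  homogenization but can still have an image in degrees \<open>\<le> b\<close>.
\<close>

lemma mat_app_homogenize:
  assumes A: "homogeneous_matrix s \<beta> t \<gamma> A" and z: "z \<in> graded_part t \<gamma> {..b}"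
  shows "mat_app s t A (homogenize b \<gamma> z)
      = homogenize b \<beta> (mat_app s t (strand_matrix \<beta> \<gamma> A) z)"
proof
  fix p
  have "A p q * zterm (b - \<gamma> q) (z q) = zterm (b - \<beta> p) (strand_matrix \<beta> \<gamma> A p q * z q)"
    if "p < s" "q < t" for q
  proof (cases "z q = 0 \<or> strand_matrix \<beta> \<gamma> A p q = 0")
    case True
    then show ?thesis using homogeneous_matrix_entry[OF A that] by auto
  next
    case False
    then have "\<gamma> q \<le> b" using z that by (auto simp: graded_part_def)
    moreover have "\<beta> p \<le> \<gamma> q" using False strand_matrix_eq_0 by blast
    ultimately show ?thesis
      using homogeneous_matrix_entry[OF A that] zterm_mult_zterm[of "\<gamma> q - \<beta> p" "b - \<gamma> q"]
      by (simp add: vec_diff_nonneg_iff)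
  qed
  then show "mat_app s t A (homogenize b \<gamma> z) p
      = homogenize b \<beta> (mat_app s t (strand_matrix \<beta> \<gamma> A) z) p"
    by (simp add: mat_app_def homogenize_def zterm_sum)
qed

lemma coord_vector_eq_sum_homogenize:
  fixes v :: "nat \<Rightarrow> ('k::field, 'n::finite) mpoly"
  assumes "v \<in> coord_vectors r"
  obtains B where "finite B" "v = (\<Sum>b\<in>B. homogenize b \<beta> (strand b \<beta> v))"
proof
  define B where "B = (\<Union>q<r. (\<lambda>e. e + \<beta> q) ` zdeg ` Poly_Mapping.keys (v q))"
  show "finite B" by (simp add: B_def)
  show "v = (\<Sum>b\<in>B. homogenize b \<beta> (strand b \<beta> v))"
  proof
    fix q
    have inj: "inj_on (\<lambda>b. b - \<beta> q) B" by (simp add: inj_on_def)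
    have "v q = (\<Sum>b\<in>B. zterm (b - \<beta> q) (zcoeff (b - \<beta> q) (v q)))"
    proof (cases "q < r")
      case True
      have "zdeg ` Poly_Mapping.keys (v q) \<subseteq> (\<lambda>b. b - \<beta> q) ` B"
      proof
        fix e assume e: "e \<in> zdeg ` Poly_Mapping.keys (v q)"
        then have "e + \<beta> q \<in> B" using True by (auto simp: B_def)
        then show "e \<in> (\<lambda>b. b - \<beta> q) ` B" by (rule rev_image_eqI) simp
      qed
      then show ?thesis
        using mpoly_eq_sum_zterms[of "(\<lambda>b. b - \<beta> q) ` B" "v q"] \<open>finite B\<close>
        by (simp add: sum.reindex[OF inj])
    next
      case False
      then show ?thesis using assms by (simp add: coord_vectors_def)
    qed
    moreover have "(\<Sum>b\<in>B. homogenize b \<beta> (strand b \<beta> v)) q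
        = (\<Sum>b\<in>B. homogenize b \<beta> (strand b \<beta> v) q)"
      using \<open>finite B\<close> by (induction B rule: finite_induct) auto
    ultimately show "v q = (\<Sum>b\<in>B. homogenize b \<beta> (strand b \<beta> v)) q"
      by (simp add: homogenize_def strand_def)
  qed
qed

definition unit_vec :: "nat \<Rightarrow> nat \<Rightarrow> 'k::field" where
  "unit_vec q = (\<lambda>p. if p = q then 1 else 0)"

definition lincomb :: "nat \<Rightarrow> (nat \<Rightarrow> 'r) \<Rightarrow> (nat \<Rightarrow> nat \<Rightarrow> 'r) \<Rightarrow> nat \<Rightarrow> 'r::comm_ring_1" where
  "lincomb r z w = (\<lambda>p. \<Sum>q<r. z q * w q p)"

lemma lincomb_cong:
  assumes "\<And>q. q < r \<Longrightarrow> z q \<noteq> 0 \<Longrightarrow> w q = w' q"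
  shows "lincomb r z w = lincomb r z w'"
proof -
  have "z q * w q p = z q * w' q p" if "q < r" for q p
    using assms[OF that] by (cases "z q = 0") auto
  then show ?thesis by (simp add: lincomb_def)
qed

lemma lincomb_diff: "lincomb r z (\<lambda>q. w q - w' q) = lincomb r z w - lincomb r z w'"
  by (simp add: lincomb_def fun_eq_iff algebra_simps sum_subtractf)

lemma lincomb_unit_vec: "z \<in> coord_vectors r \<Longrightarrow> lincomb r z unit_vec = z"
  by (auto simp: lincomb_def unit_vec_def fun_eq_iff coord_vectors_def if_distrib cong: if_cong)

lemma lincomb_lincomb: "lincomb r (lincomb t z x) w = lincomb t z (\<lambda>q. lincomb r (x q) w)"
proof
  fix p
  have "lincomb r (lincomb t z x) w p = (\<Sum>i<r. \<Sum>q<t. z q * x q i * w i p)"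
    by (simp add: lincomb_def sum_distrib_right)
  also have "\<dots> = (\<Sum>q<t. \<Sum>i<r. z q * x q i * w i p)" by (rule sum.swap)
  also have "\<dots> = lincomb t z (\<lambda>q. lincomb r (x q) w) p"
    by (simp add: lincomb_def sum_distrib_left mult.assoc)
  finally show "lincomb r (lincomb t z x) w p = lincomb t z (\<lambda>q. lincomb r (x q) w) p" .
qed

lemma mat_app_lincomb:
  "mat_app s t A (lincomb r z w) = lincomb r z (\<lambda>q. mat_app s t A (w q))"
proof
  fix p
  have "(\<Sum>q<t. A p q * (\<Sum>i<r. z i * w i q)) = (\<Sum>q<t. \<Sum>i<r. z i * (A p q * w i q))"
    by (simp add: sum_distrib_left algebra_simps)
  also have "\<dots> = (\<Sum>i<r. \<Sum>q<t. z i * (A p q * w i q))" by (rule sum.swap)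
  finally show "mat_app s t A (lincomb r z w) p = lincomb r z (\<lambda>q. mat_app s t A (w q)) p"
    by (simp add: mat_app_def lincomb_def sum_distrib_left)
qed

section \<open>Existence of a graded resolution\<close>

lemma sum_fun_apply: "(\<Sum>x\<in>X. f x) q = (\<Sum>x\<in>X. f x q)"
  by (induction X rule: infinite_finite_induct) auto

lemma mat_app_scale: "mat_app s t A (\<lambda>q. c * v q) = (\<lambda>p. c * mat_app s t A v p)"
  by (auto simp: mat_app_def fun_eq_iff sum_distrib_left mult_ac)

lemma coord_vectors_add: "v \<in> coord_vectors r \<Longrightarrow> w \<in> coord_vectors r \<Longrightarrow> v + w \<in> coord_vectors r"
  for v w :: "nat \<Rightarrow> 'a::monoid_add"
  by (simp add: coord_vectors_def)

lemma coord_vectors_sum: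
  fixes v :: "'b \<Rightarrow> nat \<Rightarrow> 'a::comm_monoid_add"
  shows "(\<And>x. x \<in> X \<Longrightarrow> v x \<in> coord_vectors r) \<Longrightarrow> (\<Sum>x\<in>X. v x) \<in> coord_vectors r"
  by (auto simp: coord_vectors_def sum_fun_apply)

text \<open>
  Linear algebra in the space of all sequences; every subspace in use lies in some
  \<^term>\<open>coord_vectors t\<close>, which makes it finite-dimensional.
\<close>

interpretation coord: vector_space "\<lambda>(c::'k::field) (w :: nat \<Rightarrow> 'k) q. c * w q"
  by (rule vector_space_pointwise)

lemma coord_vectors_subset_span:
  "coord_vectors t \<subseteq> coord.span ((unit_vec :: nat \<Rightarrow> nat \<Rightarrow> 'k::field) ` {..<t})"
proof
  fix z :: "nat \<Rightarrow> 'k" assume z: "z \<in> coord_vectors t"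
  have "(\<Sum>q<t. (\<lambda>p. z q * unit_vec q p)) \<in> coord.span (unit_vec ` {..<t})"
    by (intro coord.span_sum coord.span_scale coord.span_base) auto
  also have "(\<Sum>q<t. (\<lambda>p. z q * unit_vec q p)) = lincomb t z unit_vec"
    by (simp add: lincomb_def fun_eq_iff sum_fun_apply)
  finally show "z \<in> coord.span (unit_vec ` {..<t})" by (simp only: lincomb_unit_vec[OF z])
qed

lemma finite_basis_of_coord_vectors:
  assumes "N \<subseteq> coord_vectors t"
  obtains G where "finite G" "G \<subseteq> N" "N \<subseteq> coord.span G" "coord.independent G" "card G = kdim N"
proof -
  obtain G where G: "G \<subseteq> N" "coord.independent G" "N \<subseteq> coord.span G" "card G = coord.dim N"
    using coord.basis_exists by metis
  moreover have "G \<subseteq> coord.span (unit_vec ` {..<t})"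
    using G(1) assms coord_vectors_subset_span by blast
  then have "finite G"
    using coord.independent_span_bound[OF _ G(2)] by blast
  ultimately show thesis using that by (auto simp: kdim_def)
qed

text \<open>
  Finite generation of the kernel of a homogeneous matrix comes from linear algebra: its strand at \<open>b\<close>
  depends only on the set \<open>Q\<close> of basis elements of degree \<open>\<le> b\<close>, and it occurs already at the join of
  the degrees of \<open>Q\<close>. So it suffices to take, for each of the finitely many sets \<open>Q\<close>, a spanning set of
  the kernel vectors supported on \<open>Q\<close>, placed in the degree \<open>join Q\<close>.
\<close>

lemma exists_syzygy_matrix:
  fixes A :: "nat \<Rightarrow> nat \<Rightarrow> ('k::field, 'n::finite) mpoly" and \<beta> \<gamma> :: "nat \<Rightarrow> int ^ 'n"
  assumes A: "homogeneous_matrix s \<beta> t \<gamma> A"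
  shows "\<exists>u \<delta> B. homogeneous_matrix t \<gamma> u \<delta> B \<and>
    {v \<in> coord_vectors t. mat_app s t A v = 0} = mat_app t u B ` coord_vectors u"
proof -
  let ?M = "strand_matrix \<beta> \<gamma> A"
  define N where "N Q = {z \<in> coord_vectors t. mat_app s t ?M z = 0 \<and> (\<forall>q. z q \<noteq> 0 \<longrightarrow> q \<in> Q)}" for Q
  define join where "join Q = (\<chi> j. Max ((\<lambda>q. \<gamma> q $ j) ` Q))" for Q
  have "\<exists>G. finite G \<and> G \<subseteq> N Q \<and> N Q \<subseteq> coord.span G" for Q
    by (rule finite_basis_of_coord_vectors[of "N Q" t]) (auto simp: N_def)
  then obtain G where G: "finite (G Q)" "G Q \<subseteq> N Q" "N Q \<subseteq> coord.span (G Q)" for Q by metis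
  \<comment> \<open>The empty set is excluded because it has no join; it supports only the zero vector.\<close>
  define P where "P = (\<Union>Q\<in>Pow {..<t} - {{}}. Pair (join Q) ` G Q)"
  have "finite P" using G(1) by (simp add: P_def)
  then obtain e where e: "bij_betw e {0..<card P} P" using ex_bij_betw_nat_finite by blast
  define u where "u = card P"
  define \<delta> where "\<delta> k = fst (e k)" for k
  define g where "g k = snd (e k)" for k
  define B where "B p k = homogenize (\<delta> k) \<gamma> (g k) p" for p k
  have join_ub: "\<gamma> q \<le> join Q" if "q \<in> Q" "Q \<subseteq> {..<t}" for q Q
    using that finite_subset[OF that(2)] by (auto simp: less_eq_vec_def join_def)
  have g: "g k \<in> graded_part t \<gamma> {..\<delta> k}" "mat_app s t ?M (g k) = 0" if k: "k < u" for k
  proof -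
    have "e k \<in> P" using e k bij_betwE unfolding u_def by fastforce
    then obtain Q y where "Q \<subseteq> {..<t}" "y \<in> G Q" "e k = (join Q, y)"
      unfolding P_def by blast
    then have Q: "Q \<subseteq> {..<t}" "g k \<in> G Q" "\<delta> k = join Q"
      by (simp_all add: g_def \<delta>_def)
    then have "g k \<in> N Q" using G(2) by blast
    then show "g k \<in> graded_part t \<gamma> {..\<delta> k}" "mat_app s t ?M (g k) = 0"
      using join_ub Q by (auto simp: N_def graded_part_def)
  qed
  have B: "homogeneous_matrix t \<gamma> u \<delta> B"
    by (simp add: homogeneous_matrix_def B_def homogenize_def homogeneous_zterm)
  have MB: "strand_matrix \<gamma> \<delta> B p k = g k p" if "k < u" for p k
    using fun_cong[OF strand_homogenize[OF g(1)[OF that]], of p]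
    by (simp add: strand_matrix_def B_def strand_def)
  have B_lincomb: "mat_app t u B w = lincomb u w (\<lambda>k. homogenize (\<delta> k) \<gamma> (g k))" for w
  proof
    fix p
    have "homogenize (\<delta> k) \<gamma> (g k) p = 0" if "k < u" "\<not> p < t" for k
      using g(1)[OF that(1)] that(2) by (simp add: graded_part_def coord_vectors_def homogenize_def)
    then show "mat_app t u B w p = lincomb u w (\<lambda>k. homogenize (\<delta> k) \<gamma> (g k)) p"
      by (auto simp: mat_app_def lincomb_def B_def mult.commute)
  qed
  have "mat_app s t A (mat_app t u B w) = 0" for w
  proof -
    have "mat_app s t A (mat_app t u B w)
        = lincomb u w (\<lambda>k. mat_app s t A (homogenize (\<delta> k) \<gamma> (g k)))"
      by (simp only: B_lincomb mat_app_lincomb)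
    also have "\<dots> = lincomb u w (\<lambda>k. 0)"
      by (intro lincomb_cong) (simp only: mat_app_homogenize[OF A g(1)] g(2) homogenize_zero)
    also have "\<dots> = 0" by (simp add: lincomb_def fun_eq_iff)
    finally show ?thesis .
  qed
  moreover have "v \<in> mat_app t u B ` coord_vectors u"
    if v: "v \<in> coord_vectors t" "mat_app s t A v = 0" for v
  proof -
    have "\<exists>x\<in>coord_vectors u. homogenize b \<gamma> (strand b \<gamma> v) = mat_app t u B x" for b
    proof -
      let ?z = "strand b \<gamma> v"
      let ?W = "mat_app t u (strand_matrix \<gamma> \<delta> B) ` graded_part u \<delta> {..b}"
      have z: "?z \<in> graded_part t \<gamma> {..b}" using v(1) by (rule strand_in_graded_part)
      have Mz: "mat_app s t ?M ?z = 0"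
        by (simp only: strand_mat_app[OF A, symmetric] v(2) strand_zero)
      have W: "coord.subspace ?W"
      proof (rule coord.subspaceI)
        have "0 \<in> graded_part u \<delta> {..b}" by (simp add: graded_part_def coord_vectors_def)
        then show "0 \<in> ?W" using mat_app_zero by (metis image_eqI)
      next
        fix x y assume "x \<in> ?W" "y \<in> ?W"
        then obtain x' y' where xy: "x' \<in> graded_part u \<delta> {..b}" "y' \<in> graded_part u \<delta> {..b}"
          "x = mat_app t u (strand_matrix \<gamma> \<delta> B) x'" "y = mat_app t u (strand_matrix \<gamma> \<delta> B) y'"
          by blast
        have "x' + y' \<in> graded_part u \<delta> {..b}"
          using xy(1,2) by (auto simp: graded_part_def coord_vectors_def)
        then show "x + y \<in> ?W" unfolding xy mat_app_add[symmetric] by (rule imageI)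
      next
        fix c x assume "x \<in> ?W"
        then obtain x' where x: "x' \<in> graded_part u \<delta> {..b}"
          "x = mat_app t u (strand_matrix \<gamma> \<delta> B) x'" by blast
        have "(\<lambda>q. c * x' q) \<in> graded_part u \<delta> {..b}"
          using x(1) by (auto simp: graded_part_def coord_vectors_def)
        then show "(\<lambda>q. c * x q) \<in> ?W" unfolding x mat_app_scale[symmetric] by (rule imageI)
      qed
      have "?z \<in> ?W"
      proof (cases "?z = 0")
        case True
        then show ?thesis using coord.subspace_0[OF W] by (simp only:)
      next
        case False
        define Q where "Q = {q. ?z q \<noteq> 0}"
        have Q: "Q \<subseteq> {..<t}" "Q \<noteq> {}"
          using z False by (auto simp: Q_def graded_part_def coord_vectors_def fun_eq_iff not_less[symmetric])
        have "\<gamma> q \<le> b" if "q \<in> Q" for q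
          using that z Q(1) by (auto simp: graded_part_def Q_def)
        then have join: "join Q \<le> b"
          using Q finite_subset[OF Q(1)] by (auto simp: less_eq_vec_def join_def)
        have "G Q \<subseteq> ?W"
        proof
          fix y assume y: "y \<in> G Q"
          have "(join Q, y) \<in> P" using y Q by (auto simp: P_def)
          also have "P = e ` {0..<u}" using e by (simp add: bij_betw_def u_def)
          finally obtain k where k: "k < u" "e k = (join Q, y)" by auto
          then have dg: "\<delta> k = join Q" "g k = y" by (simp_all add: \<delta>_def g_def)
          let ?x = "\<lambda>i. if i = k then 1 else 0"
          have "?x \<in> graded_part u \<delta> {..b}"
            using k(1) dg join by (simp add: graded_part_def coord_vectors_def)
          moreover have "y \<in> coord_vectors t" using y G(2) by (auto simp: N_def)
          then have "mat_app t u (strand_matrix \<gamma> \<delta> B) ?x = y"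
            using k(1) MB[OF k(1)] dg
            by (auto simp: mat_app_def fun_eq_iff coord_vectors_def if_distrib cong: if_cong)
          ultimately show "y \<in> ?W" by (intro image_eqI) simp_all
        qed
        moreover have "?z \<in> N Q"
          using z Mz by (auto simp: N_def Q_def graded_part_def)
        ultimately show ?thesis using G(3) coord.span_minimal[OF _ W] by blast
      qed
      then obtain c where c: "c \<in> graded_part u \<delta> {..b}" "?z = mat_app t u (strand_matrix \<gamma> \<delta> B) c"
        by blast
      have "homogenize b \<gamma> ?z = mat_app t u B (homogenize b \<delta> c)"
        unfolding mat_app_homogenize[OF B c(1)] c(2) ..
      moreover have "homogenize b \<delta> c \<in> coord_vectors u"
        using c(1) by (auto simp: graded_part_def intro: homogenize_in_coord_vectors)
      ultimately show ?thesis by blast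
    qed
    then obtain x where x: "x b \<in> coord_vectors u"
        "homogenize b \<gamma> (strand b \<gamma> v) = mat_app t u B (x b)" for b by metis
    obtain E where "v = (\<Sum>b\<in>E. homogenize b \<gamma> (strand b \<gamma> v))"
      by (rule coord_vector_eq_sum_homogenize[OF v(1)])
    also have "\<dots> = mat_app t u B (\<Sum>b\<in>E. x b)" by (simp only: x(2) mat_app_sum)
    finally show ?thesis using coord_vectors_sum[of E x u] x(1) by blast
  qed
  ultimately have "{v \<in> coord_vectors t. mat_app s t A v = 0} = mat_app t u B ` coord_vectors u"
    using mat_app_in_coord_vectors by blast
  with B show ?thesis by blast
qed

lemma ideal_of_eq_combinations:
  fixes u :: "nat \<Rightarrow> ('k::field, 'n::finite) mpoly"
  shows "ideal_of (u ` {1..r}) = {\<Sum>q<r. u (Suc q) * w q | w. w \<in> coord_vectors r}" (is "_ = ?J")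
proof -
  interpret S: module "(*) :: ('k, 'n) mpoly \<Rightarrow> _" by (rule module_mult)
  have "S.subspace ?J"
  proof (rule S.subspaceI)
    have "0 = (\<Sum>q<r. u (Suc q) * (0 :: nat \<Rightarrow> ('k, 'n) mpoly) q)" by simp
    then show "0 \<in> ?J" by (fastforce simp: coord_vectors_def)
  next
    fix x y assume "x \<in> ?J" "y \<in> ?J"
    then obtain v w where "v \<in> coord_vectors r" "w \<in> coord_vectors r"
      "x = (\<Sum>q<r. u (Suc q) * v q)" "y = (\<Sum>q<r. u (Suc q) * w q)" by blast
    then have "x + y = (\<Sum>q<r. u (Suc q) * (v + w) q)" "v + w \<in> coord_vectors r"
      by (simp_all add: sum.distrib distrib_left coord_vectors_add)
    then show "x + y \<in> ?J" by blast
  next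
    fix c x assume "x \<in> ?J"
    then obtain v where v: "v \<in> coord_vectors r" "x = (\<Sum>q<r. u (Suc q) * v q)" by blast
    have "c * x = (\<Sum>q<r. u (Suc q) * (\<lambda>q. c * v q) q)"
      unfolding v(2) sum_distrib_left by (simp only: mult.left_commute)
    moreover have "(\<lambda>q. c * v q) \<in> coord_vectors r"
      using v(1) by (simp add: coord_vectors_def)
    ultimately show "c * x \<in> ?J" by (intro CollectI exI[of _ "\<lambda>q. c * v q"] conjI) simp_all
  qed
  moreover have "u ` {1..r} \<subseteq> ?J"
  proof (rule image_subsetI)
    fix l assume l: "l \<in> {1..r}"
    let ?w = "\<lambda>q. if q = l - 1 then 1 else 0"
    have "l - 1 < r" "Suc (l - 1) = l" using l by auto
    then have "u l = (\<Sum>q<r. u (Suc q) * ?w q)"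
      by (simp add: if_distrib cong: if_cong)
    moreover have "?w \<in> coord_vectors r" using l by (auto simp: coord_vectors_def)
    ultimately show "u l \<in> ?J" by (intro CollectI exI[of _ ?w] conjI)
  qed
  ultimately have "S.span (u ` {1..r}) \<subseteq> ?J" by (rule S.span_minimal[rotated])
  moreover have "(\<Sum>q<r. u (Suc q) * w q) \<in> S.span (u ` {1..r})" for w
  proof (rule S.span_sum)
    fix q assume "q \<in> {..<r}"
    then have "w q * u (Suc q) \<in> S.span (u ` {1..r})"
      by (intro S.span_scale S.span_base) auto
    then show "u (Suc q) * w q \<in> S.span (u ` {1..r})" by (simp only: mult.commute)
  qed
  ultimately show ?thesis unfolding ideal_of_def by blast
qed

text \<open>
  The resolution starts with \<open>S\<close> and the row of the generators and continues with syzygy matrices.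
\<close>

lemma exists_graded_resolution:
  fixes \<alpha> :: "nat \<Rightarrow> nat ^ 'n" and u :: "nat \<Rightarrow> ('k::field, 'n::finite) mpoly"
  assumes u: "\<And>l. l \<in> {1..r} \<Longrightarrow> u l = xmonom (\<alpha> l)"
  shows "\<exists>F. graded_resolution (ideal_of (u ` {1..r})) F"
proof -
  define P where "P = (\<lambda>(s :: nat, \<beta> :: nat \<Rightarrow> int ^ 'n, t, \<gamma>, A :: nat \<Rightarrow> nat \<Rightarrow> ('k, 'n) mpoly).
      homogeneous_matrix s \<beta> t \<gamma> A)"
  define R where "R = (\<lambda>(s :: nat, \<beta> :: nat \<Rightarrow> int ^ 'n, t, \<gamma>, A :: nat \<Rightarrow> nat \<Rightarrow> ('k, 'n) mpoly)
      (s', \<beta>' :: nat \<Rightarrow> int ^ 'n, t', \<gamma>' :: nat \<Rightarrow> int ^ 'n, B). s' = t \<and> \<beta>' = \<gamma> \<and>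
      {v \<in> coord_vectors t. mat_app s t A v = 0} = mat_app t t' B ` coord_vectors t')"
  define x0 where "x0 = (1 :: nat, \<lambda>_ :: nat. 0 :: int ^ 'n, r, \<lambda>q. zdeg (\<alpha> (Suc q)),
      \<lambda>(_ :: nat) q. u (Suc q))"
  have "P x0"
    using u by (auto simp: P_def x0_def homogeneous_matrix_def xmonom_eq_zterm homogeneous_zterm)
  have step: "\<exists>y. P y \<and> R x y" if "P x" for x
  proof -
    obtain s \<beta> t \<gamma> A where x: "x = (s, \<beta>, t, \<gamma>, A)" by (cases x)
    with that have "homogeneous_matrix s \<beta> t \<gamma> A" by (simp add: P_def)
    from exists_syzygy_matrix[OF this] obtain t' \<delta> B where "homogeneous_matrix t \<gamma> t' \<delta> B"
      "{v \<in> coord_vectors t. mat_app s t A v = 0} = mat_app t t' B ` coord_vectors t'" by blast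
    then show ?thesis by (intro exI[of _ "(t, \<gamma>, t', \<delta>, B)"]) (simp add: P_def R_def x)
  qed
  have "\<exists>X. \<forall>n. (P (X n) \<and> (n = 0 \<longrightarrow> X n = x0)) \<and> R (X n) (X (Suc n))"
  proof (rule dependent_nat_choice)
    show "\<exists>x. P x \<and> (0 = (0 :: nat) \<longrightarrow> x = x0)" using \<open>P x0\<close> by blast
    show "\<exists>y. (P y \<and> (Suc n = 0 \<longrightarrow> y = x0)) \<and> R x y" if "P x \<and> (n = 0 \<longrightarrow> x = x0)" for x n
      using step that by blast
  qed
  then obtain X where X: "P (X n)" "X 0 = x0" "R (X n) (X (Suc n))" for n by blast
  define F :: "('k, 'n) free_complex" where
    "F = \<lparr>rk = \<lambda>i. fst (X i), bdeg = \<lambda>i. fst (snd (X i)),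
      dmat = \<lambda>i. snd (snd (snd (snd (X i)))), aug = \<lambda>_. 1\<rparr>"
  have Xi: "X i = (rk F i, bdeg F i, rk F (Suc i), bdeg F (Suc i), dmat F i)" for i
    using X(3)[of i] by (cases "X i"; cases "X (Suc i)") (simp add: F_def R_def)
  have hom: "homogeneous_matrix (rk F i) (bdeg F i) (rk F (Suc i)) (bdeg F (Suc i)) (dmat F i)" for i
    using X(1)[of i] by (simp add: Xi P_def)
  have exact: "{v \<in> free_mod F (Suc i). diff_map F i v = 0}
      = diff_map F (Suc i) ` free_mod F (Suc (Suc i))" for i
    using X(3)[of i] by (simp add: Xi R_def free_mod_def diff_map_def)
  have F0: "rk F 0 = 1" "bdeg F 0 = (\<lambda>_. 0)" "rk F (Suc 0) = r" "dmat F 0 = (\<lambda>_ q. u (Suc q))"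
    using Xi[of 0] by (simp_all add: X(2) x0_def)
  have F_aug: "aug F q = 1" for q by (simp add: F_def)
  have aug_map: "aug_map F v = v 0" for v by (simp add: aug_map_def F0 F_aug)
  have I: "f \<in> ideal_of (u ` {1..r}) \<longleftrightarrow> (\<exists>w\<in>coord_vectors r. f = (\<Sum>q<r. u (Suc q) * w q))" for f
    unfolding ideal_of_eq_combinations by blast
  show ?thesis
  proof (rule exI[of _ F], unfold graded_resolution_def, intro conjI)
    show "\<forall>q<rk F 0. homogeneous (bdeg F 0 q) (aug F q)"
      using homogeneous_zterm[of 0 1] by (simp add: F0 F_aug zterm_zero_one)
    show "\<forall>i. \<forall>p<rk F i. \<forall>q<rk F (Suc i).
        homogeneous (bdeg F (Suc i) q - bdeg F i p) (dmat F i p q)"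
      using hom by (auto simp: homogeneous_matrix_def)
    show "\<forall>f. \<exists>v\<in>free_mod F 0. f - aug_map F v \<in> ideal_of (u ` {1..r})"
    proof
      fix f :: "('k, 'n) mpoly"
      have "(\<lambda>q. if q = 0 then f else 0) \<in> free_mod F 0"
        by (simp add: free_mod_def coord_vectors_def F0)
      moreover have "0 \<in> ideal_of (u ` {1..r})"
        unfolding ideal_of_def by (rule module.span_zero[OF module_mult])
      ultimately show "\<exists>v\<in>free_mod F 0. f - aug_map F v \<in> ideal_of (u ` {1..r})"
        by (intro bexI[of _ "\<lambda>q. if q = 0 then f else 0"]) (simp_all add: aug_map)
    qed
    have diff0: "v = diff_map F 0 w \<longleftrightarrow> v 0 = (\<Sum>q<r. u (Suc q) * w q)"
      if "v \<in> coord_vectors 1" for v w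
      using that by (auto simp: diff_map_def mat_app_def F0 fun_eq_iff coord_vectors_def)
    have fm: "free_mod F 0 = coord_vectors 1" "free_mod F 1 = coord_vectors r"
      by (simp_all add: free_mod_def F0)
    have im: "diff_map F 0 w \<in> coord_vectors 1" for w
      unfolding diff_map_def F0 by (rule mat_app_in_coord_vectors)
    have "v \<in> coord_vectors 1 \<and> v 0 \<in> ideal_of (u ` {1..r}) \<longleftrightarrow>
        v \<in> diff_map F 0 ` coord_vectors r" for v
    proof (intro iffI; (elim conjE)?)
      assume v: "v \<in> coord_vectors 1" "v 0 \<in> ideal_of (u ` {1..r})"
      obtain w where w: "w \<in> coord_vectors r" "v 0 = (\<Sum>q<r. u (Suc q) * w q)"
        using v(2) unfolding I by blast
      then have "v = diff_map F 0 w" using diff0[OF v(1)] by blast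
      with w(1) show "v \<in> diff_map F 0 ` coord_vectors r" by blast
    next
      assume "v \<in> diff_map F 0 ` coord_vectors r"
      then obtain w where w: "v = diff_map F 0 w" "w \<in> coord_vectors r" by (rule imageE)
      then have v: "v \<in> coord_vectors 1" using im by simp
      have "v 0 = (\<Sum>q<r. u (Suc q) * w q)" using diff0[OF v] w(1) by blast
      then have "v 0 \<in> ideal_of (u ` {1..r})" unfolding I using w(2) by blast
      with v show "v \<in> coord_vectors 1 \<and> v 0 \<in> ideal_of (u ` {1..r})" by (rule conjI)
    qed
    then show "{v \<in> free_mod F 0. aug_map F v \<in> ideal_of (u ` {1..r})} = diff_map F 0 ` free_mod F 1"
      unfolding fm aug_map set_eq_iff mem_Collect_eq by (rule allI)
    show "\<forall>i. {v \<in> free_mod F (Suc i). diff_map F i v = 0}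
        = diff_map F (Suc i) ` free_mod F (Suc (Suc i))"
      using exact by blast
  qed
qed

section \<open>The strands of a graded resolution\<close>

lemma tensor_part_eq_graded_part: "tensor_part F i D = graded_part (rk F i) (bdeg F i) D"
  by (simp add: tensor_part_def graded_part_def)

lemma tensor_part_mono: "D \<subseteq> E \<Longrightarrow> w \<in> tensor_part F i D \<Longrightarrow> w \<in> tensor_part F i E"
  by (auto simp: tensor_part_def)

lemma tensor_part_add:
  "v \<in> tensor_part F i D \<Longrightarrow> w \<in> tensor_part F i D \<Longrightarrow> v + w \<in> tensor_part F i D"
  by (auto simp: tensor_part_def coord_vectors_def)

lemma tensor_part_diff:
  "v \<in> tensor_part F i D \<Longrightarrow> w \<in> tensor_part F i D \<Longrightarrow> v - w \<in> tensor_part F i D"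
  by (auto simp: tensor_part_def coord_vectors_def)

lemma zero_in_tensor_part: "0 \<in> tensor_part F i D"
  by (auto simp: tensor_part_def coord_vectors_def)

lemma unit_vec_in_tensor_part: "q < rk F i \<Longrightarrow> bdeg F i q \<in> D \<Longrightarrow> unit_vec q \<in> tensor_part F i D"
  by (auto simp: tensor_part_def coord_vectors_def unit_vec_def)

lemma lincomb_in_tensor_part:
  assumes "\<And>q. q < r \<Longrightarrow> z q \<noteq> 0 \<Longrightarrow> w q \<in> tensor_part F i D"
  shows "lincomb r z w \<in> tensor_part F i D"
proof -
  have "bdeg F i p \<in> D" if p: "p < rk F i" "lincomb r z w p \<noteq> 0" for p
  proof -
    obtain q where "q \<in> {..<r}" "z q * w q p \<noteq> 0"
      using p(2) unfolding lincomb_def by (rule sum.not_neutral_contains_not_neutral)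
    then show ?thesis using assms[of q] p(1) by (auto simp: tensor_part_def)
  qed
  moreover have "lincomb r z w p = 0" if "p \<ge> rk F i" for p
    unfolding lincomb_def using that assms
    by (intro sum.neutral) (auto simp: tensor_part_def coord_vectors_def)
  ultimately show ?thesis by (auto simp: tensor_part_def coord_vectors_def)
qed

text \<open>
  The differential with all variables set to \<open>1\<close>. Restricted to the vectors supported in degrees
  \<open>\<le> b\<close> it is the differential of the strand at \<open>b\<close>.
\<close>

definition strand_diff :: "('k::field, 'n::finite) free_complex \<Rightarrow> nat \<Rightarrow> (nat \<Rightarrow> 'k) \<Rightarrow> nat \<Rightarrow> 'k" where
  "strand_diff F i =
     mat_app (rk F i) (rk F (Suc i)) (strand_matrix (bdeg F i) (bdeg F (Suc i)) (dmat F i))"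

lemma
  shows strand_diff_add: "strand_diff F i (v + w) = strand_diff F i v + strand_diff F i w"
    and strand_diff_diff: "strand_diff F i (v - w) = strand_diff F i v - strand_diff F i w"
    and strand_diff_lincomb:
      "strand_diff F i (lincomb r z x) = lincomb r z (\<lambda>q. strand_diff F i (x q))"
  by (simp_all only: strand_diff_def mat_app_add mat_app_diff mat_app_lincomb)

lemma strand_diff_in_coord_vectors: "strand_diff F i w \<in> coord_vectors (rk F i)"
  by (simp add: strand_diff_def mat_app_in_coord_vectors)

lemma strand_diff_in_tensor_part:
  assumes w: "w \<in> tensor_part F (Suc i) D" and down: "\<And>x y. x \<in> D \<Longrightarrow> y \<le> x \<Longrightarrow> y \<in> E"
  shows "strand_diff F i w \<in> tensor_part F i E"
proof -
  have "bdeg F i p \<in> E" if p: "p < rk F i" "strand_diff F i w p \<noteq> 0" for p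
  proof -
    have "(\<Sum>q<rk F (Suc i). strand_matrix (bdeg F i) (bdeg F (Suc i)) (dmat F i) p q * w q) \<noteq> 0"
      using p by (simp add: strand_diff_def mat_app_def)
    then obtain q where q: "q \<in> {..<rk F (Suc i)}"
        "strand_matrix (bdeg F i) (bdeg F (Suc i)) (dmat F i) p q * w q \<noteq> 0"
      by (rule sum.not_neutral_contains_not_neutral)
    then have "bdeg F (Suc i) q \<in> D" using w by (auto simp: tensor_part_def)
    moreover have "bdeg F i p \<le> bdeg F (Suc i) q" using q strand_matrix_eq_0 by fastforce
    ultimately show ?thesis using down by blast
  qed
  then show ?thesis using strand_diff_in_coord_vectors by (auto simp: tensor_part_def)
qed

lemma resolution_homogeneous:
  assumes "graded_resolution I F"
  shows "homogeneous_matrix (rk F i) (bdeg F i) (rk F (Suc i)) (bdeg F (Suc i)) (dmat F i)"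
  using assms by (auto simp: graded_resolution_def homogeneous_matrix_def)

lemma strand_homogenize_tensor_part:
  "z \<in> tensor_part F i {..b} \<Longrightarrow> strand b (bdeg F i) (homogenize b (bdeg F i) z) = z"
  unfolding tensor_part_eq_graded_part by (rule strand_homogenize)

lemma
  assumes "graded_resolution I F"
  shows resolution_exact: "{v \<in> free_mod F (Suc i). diff_map F i v = 0}
      = diff_map F (Suc i) ` free_mod F (Suc (Suc i))"
    and resolution_exact_0: "{v \<in> free_mod F 0. aug_map F v \<in> I} = diff_map F 0 ` free_mod F 1"
    and resolution_aug_surj: "\<exists>v\<in>free_mod F 0. f - aug_map F v \<in> I"
  using assms unfolding graded_resolution_def by simp_all

lemma strand_diff_map:
  assumes "graded_resolution I F"
  shows "strand b (bdeg F i) (diff_map F i v) = strand_diff F i (strand b (bdeg F (Suc i)) v)"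
  unfolding diff_map_def strand_diff_def by (rule strand_mat_app[OF resolution_homogeneous[OF assms]])

lemma diff_map_homogenize:
  assumes "graded_resolution I F" "z \<in> tensor_part F (Suc i) {..b}"
  shows "diff_map F i (homogenize b (bdeg F (Suc i)) z) = homogenize b (bdeg F i) (strand_diff F i z)"
  unfolding diff_map_def strand_diff_def using assms
  by (intro mat_app_homogenize resolution_homogeneous) (auto simp: tensor_part_eq_graded_part)

lemma strand_diff_strand_diff:
  assumes F: "graded_resolution I F" and z: "z \<in> tensor_part F (Suc (Suc i)) {..b}"
  shows "strand_diff F i (strand_diff F (Suc i) z) = 0"
proof -
  let ?v = "homogenize b (bdeg F (Suc (Suc i))) z"
  have "?v \<in> free_mod F (Suc (Suc i))"
    using z by (auto simp: free_mod_def tensor_part_def intro!: homogenize_in_coord_vectors)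
  then have "diff_map F (Suc i) ?v \<in> {v \<in> free_mod F (Suc i). diff_map F i v = 0}"
    unfolding resolution_exact[OF F] by (rule imageI)
  then have "diff_map F i (diff_map F (Suc i) ?v) = 0" by blast
  then have "strand b (bdeg F i) (diff_map F i (diff_map F (Suc i) ?v)) = 0"
    by (simp only: strand_zero)
  then show ?thesis
    by (simp add: strand_diff_map[OF F] strand_homogenize_tensor_part[OF z])
qed

text \<open>
  The strand at \<open>b\<close> inherits exactness from the resolution: homogenize to degree \<open>b\<close>, lift, and take
  the degree-\<open>b\<close> component of the lift.
\<close>

lemma strand_exact:
  assumes F: "graded_resolution I F" and z: "z \<in> tensor_part F (Suc i) {..b}"
    and cyc: "strand_diff F i z = 0"
  obtains w where "w \<in> tensor_part F (Suc (Suc i)) {..b}" "strand_diff F (Suc i) w = z"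
proof -
  let ?v = "homogenize b (bdeg F (Suc i)) z"
  have "?v \<in> free_mod F (Suc i)"
    using z by (auto simp: free_mod_def tensor_part_def intro!: homogenize_in_coord_vectors)
  moreover have "diff_map F i ?v = 0"
    by (simp only: diff_map_homogenize[OF F z] cyc homogenize_zero)
  ultimately have "?v \<in> {v \<in> free_mod F (Suc i). diff_map F i v = 0}" by blast
  also note resolution_exact[OF F]
  finally obtain u where u: "u \<in> free_mod F (Suc (Suc i))" "?v = diff_map F (Suc i) u" by blast
  show thesis
  proof
    show "strand b (bdeg F (Suc (Suc i))) u \<in> tensor_part F (Suc (Suc i)) {..b}"
      using u(1) by (simp add: tensor_part_eq_graded_part free_mod_def strand_in_graded_part)
    have "strand_diff F (Suc i) (strand b (bdeg F (Suc (Suc i))) u) = strand b (bdeg F (Suc i)) ?v"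
      by (simp only: u(2) strand_diff_map[OF F])
    then show "strand_diff F (Suc i) (strand b (bdeg F (Suc (Suc i))) u) = z"
      by (simp only: strand_homogenize_tensor_part[OF z])
  qed
qed

definition strand_aug :: "('k::field, 'n::finite) free_complex \<Rightarrow> nat \<Rightarrow> 'k" where
  "strand_aug F q = zcoeff (bdeg F 0 q) (aug F q)"

text \<open>
  Viewing the augmentation as a matrix with a single row in degree \<open>0\<close> makes the results on homogeneous
  matrices apply to it.
\<close>

lemma aug_map_eq_mat_app: "aug_map F v = mat_app 1 (rk F 0) (\<lambda>_. aug F) v 0"
  by (simp add: aug_map_def mat_app_def)

lemma aug_homogeneous:
  assumes "graded_resolution I F"
  shows "homogeneous_matrix 1 (\<lambda>_. 0) (rk F 0) (bdeg F 0) (\<lambda>_. aug F)"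
  using assms by (auto simp: graded_resolution_def homogeneous_matrix_def)

lemma zcoeff_aug_map:
  assumes "graded_resolution I F"
  shows "zcoeff b (aug_map F v) = (\<Sum>q<rk F 0. strand_aug F q * strand b (bdeg F 0) v q)"
  using fun_cong[OF strand_mat_app[OF aug_homogeneous[OF assms], of b v], of 0]
  by (simp add: aug_map_eq_mat_app strand_def[of b "\<lambda>_. 0"])
    (simp add: mat_app_def strand_matrix_def strand_aug_def)

lemma aug_map_homogenize:
  assumes "graded_resolution I F" "z \<in> tensor_part F 0 {..b}"
  shows "aug_map F (homogenize b (bdeg F 0) z) = zterm b (\<Sum>q<rk F 0. strand_aug F q * z q)"
  using fun_cong[OF mat_app_homogenize[OF aug_homogeneous[OF assms(1)], of z b], of 0] assms(2)
  by (simp add: aug_map_eq_mat_app homogenize_def[of b "\<lambda>_. 0"] tensor_part_eq_graded_part)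
    (simp add: mat_app_def strand_matrix_def strand_aug_def)

lemma strand_exact_0:
  assumes F: "graded_resolution I F" and z: "z \<in> tensor_part F 0 {..b}"
    and cyc: "zterm b (\<Sum>q<rk F 0. strand_aug F q * z q) \<in> I"
  obtains w where "w \<in> tensor_part F (Suc 0) {..b}" "strand_diff F 0 w = z"
proof -
  let ?v = "homogenize b (bdeg F 0) z"
  have "?v \<in> free_mod F 0"
    using z by (auto simp: free_mod_def tensor_part_def intro!: homogenize_in_coord_vectors)
  moreover have "aug_map F ?v \<in> I"
    using aug_map_homogenize[OF F z] cyc by simp
  ultimately have "?v \<in> {v \<in> free_mod F 0. aug_map F v \<in> I}" by blast
  also note resolution_exact_0[OF F]
  finally obtain u where u: "u \<in> free_mod F 1" "?v = diff_map F 0 u" by blast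
  show thesis
  proof
    show "strand b (bdeg F (Suc 0)) u \<in> tensor_part F (Suc 0) {..b}"
      using u(1) by (simp add: tensor_part_eq_graded_part free_mod_def strand_in_graded_part)
    have "strand_diff F 0 (strand b (bdeg F (Suc 0)) u) = strand b (bdeg F 0) ?v"
      by (simp only: u(2) strand_diff_map[OF F])
    then show "strand_diff F 0 (strand b (bdeg F (Suc 0)) u) = z"
      by (simp only: strand_homogenize_tensor_part[OF z])
  qed
qed

lemma strand_aug_strand_diff:
  assumes F: "graded_resolution I F" and z: "z \<in> tensor_part F (Suc 0) {..b}"
    and I: "\<And>g. g \<in> I \<Longrightarrow> zcoeff b g = 0"
  shows "(\<Sum>q<rk F 0. strand_aug F q * strand_diff F 0 z q) = 0"
proof -
  let ?v = "homogenize b (bdeg F (Suc 0)) z"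
  have "?v \<in> free_mod F 1"
    using z by (auto simp: free_mod_def tensor_part_def intro!: homogenize_in_coord_vectors)
  then have "diff_map F 0 ?v \<in> {v \<in> free_mod F 0. aug_map F v \<in> I}"
    unfolding resolution_exact_0[OF F] by (rule imageI)
  then have "zcoeff b (aug_map F (diff_map F 0 ?v)) = 0" using I by blast
  then show ?thesis
    by (simp add: zcoeff_aug_map[OF F] strand_diff_map[OF F] strand_homogenize_tensor_part[OF z])
qed

lemma strand_aug_surj:
  fixes F :: "('k::field, 'n::finite) free_complex"
  assumes F: "graded_resolution I F" and I: "\<And>g. g \<in> I \<Longrightarrow> zcoeff 0 g = 0"
  obtains w where "w \<in> tensor_part F 0 {..0}" "(\<Sum>q<rk F 0. strand_aug F q * w q) = 1"
proof -
  obtain v where v: "v \<in> free_mod F 0" "1 - aug_map F v \<in> I"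
    using resolution_aug_surj[OF F] by blast
  have "zcoeff 0 (1 :: ('k, 'n) mpoly) = 1"
    unfolding zterm_zero_one[symmetric] zcoeff_zterm by simp
  then have "zcoeff 0 (aug_map F v) = 1"
    using I[OF v(2)] by (simp add: zcoeff_diff)
  then show thesis
    using that[of "strand 0 (bdeg F 0) v"] v(1)
    by (simp add: zcoeff_aug_map[OF F] tensor_part_eq_graded_part free_mod_def strand_in_graded_part)
qed

section \<open>Contractions of the strands\<close>

text \<open>
  The functional \<open>\<epsilon>\<close> takes the place of the augmentation in position \<open>0\<close>. Where the strands are exact
  in position \<open>0\<close> it is \<open>0\<close>, and where they resolve a strand of \<open>S\<close> it is \<^const>\<open>strand_aug\<close>.
\<close>

definition is_cycle :: "('k::field, 'n::finite) free_complex \<Rightarrow> (nat \<Rightarrow> 'k) \<Rightarrow> nat \<Rightarrow> (nat \<Rightarrow> 'k) \<Rightarrow> bool"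
  where "is_cycle F \<epsilon> i z \<longleftrightarrow>
    (case i of 0 \<Rightarrow> (\<Sum>q<rk F 0. \<epsilon> q * z q) = 0 | Suc j \<Rightarrow> strand_diff F j z = 0)"

lemma is_cycle_diff: "is_cycle F \<epsilon> i y \<Longrightarrow> is_cycle F \<epsilon> i z \<Longrightarrow> is_cycle F \<epsilon> i (y - z)"
  by (cases i) (simp_all add: is_cycle_def strand_diff_diff algebra_simps sum_subtractf)

lemma is_cycle_strand_diff:
  assumes "graded_resolution I F"
    and "\<And>z. z \<in> tensor_part F (Suc 0) {..c} \<Longrightarrow> (\<Sum>q<rk F 0. \<epsilon> q * strand_diff F 0 z q) = 0"
    and "z \<in> tensor_part F (Suc i) {..c}"
  shows "is_cycle F \<epsilon> i (strand_diff F i z)"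
  using assms strand_diff_strand_diff[OF assms(1)] by (cases i) (auto simp: is_cycle_def)

text \<open>
  The map \<open>h\<close> is the component in position \<open>i\<close> of a contracting homotopy. It is enough to keep of the
  homotopy formula \<open>d h + h d = id\<close> that \<open>d h z = z\<close> on cycles \<open>z\<close>. This makes the induction work: if \<open>h\<close>
  is the component in position \<open>i\<close>, then \<open>e - h (d e)\<close> is a cycle for every basis vector \<open>e\<close> in
  position \<open>i + 1\<close>, since \<open>d e\<close> is a cycle, and any preimage of it serves as the value at \<open>e\<close> of the next
  component. In position \<open>0\<close>, the term \<open>\<epsilon> q * w\<^sub>0 p\<close> is the part of the homotopy that passes through
  the augmentation. The monotonicity of \<open>f\<close> keeps \<open>h (d e)\<close> in the strand at \<open>f b\<close> if \<open>e\<close> has degree \<open>b\<close>.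
\<close>

lemma exists_contraction:
  fixes F :: "('k::field, 'n::finite) free_complex" and f :: "int ^ 'n \<Rightarrow> int ^ 'n"
  assumes F: "graded_resolution I F"
    and inflate: "\<And>b. b \<le> f b" and mono: "\<And>b b'. b \<le> b' \<Longrightarrow> f b \<le> f b'"
    and base: "\<And>q. q < rk F 0 \<Longrightarrow> bdeg F 0 q \<le> c \<Longrightarrow>
      \<exists>w\<in>tensor_part F (Suc 0) {..f (bdeg F 0 q)}. strand_diff F 0 w = unit_vec q - (\<lambda>p. \<epsilon> q * w\<^sub>0 p)"
    and \<epsilon>: "\<And>z. z \<in> tensor_part F (Suc 0) {..c} \<Longrightarrow> (\<Sum>q<rk F 0. \<epsilon> q * strand_diff F 0 z q) = 0"
  shows "\<exists>h. (\<forall>q<rk F i. bdeg F i q \<le> c \<longrightarrow> h q \<in> tensor_part F (Suc i) {..f (bdeg F i q)}) \<and>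
    (\<forall>z\<in>tensor_part F i {..c}. is_cycle F \<epsilon> i z \<longrightarrow> strand_diff F i (lincomb (rk F i) z h) = z)"
proof (induction i)
  case 0
  from base have "\<forall>q. \<exists>w. q < rk F 0 \<and> bdeg F 0 q \<le> c \<longrightarrow>
      w \<in> tensor_part F (Suc 0) {..f (bdeg F 0 q)} \<and> strand_diff F 0 w = unit_vec q - (\<lambda>p. \<epsilon> q * w\<^sub>0 p)"
    by blast
  from choice[OF this] obtain h where h: "\<forall>q. q < rk F 0 \<and> bdeg F 0 q \<le> c \<longrightarrow>
      h q \<in> tensor_part F (Suc 0) {..f (bdeg F 0 q)} \<and>
      strand_diff F 0 (h q) = unit_vec q - (\<lambda>p. \<epsilon> q * w\<^sub>0 p)" by blast
  have "strand_diff F 0 (lincomb (rk F 0) z h) = z"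
    if z: "z \<in> tensor_part F 0 {..c}" "is_cycle F \<epsilon> 0 z" for z
  proof -
    have "strand_diff F 0 (lincomb (rk F 0) z h)
        = lincomb (rk F 0) z (\<lambda>q. unit_vec q - (\<lambda>p. \<epsilon> q * w\<^sub>0 p))"
      unfolding strand_diff_lincomb using h z(1) by (intro lincomb_cong) (auto simp: tensor_part_def)
    also have "\<dots> = z - lincomb (rk F 0) z (\<lambda>q p. \<epsilon> q * w\<^sub>0 p)"
      using lincomb_unit_vec[of z "rk F 0"] z(1) by (simp add: lincomb_diff tensor_part_def)
    also have "lincomb (rk F 0) z (\<lambda>q p. \<epsilon> q * w\<^sub>0 p) = (\<lambda>p. (\<Sum>q<rk F 0. \<epsilon> q * z q) * w\<^sub>0 p)"
      unfolding lincomb_def sum_distrib_right by (simp add: mult_ac)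
    also have "z - \<dots> = z" using z(2) by (simp add: is_cycle_def fun_eq_iff)
    finally show ?thesis .
  qed
  with h show ?case by blast
next
  case (Suc i)
  obtain h where h: "\<forall>q<rk F i. bdeg F i q \<le> c \<longrightarrow> h q \<in> tensor_part F (Suc i) {..f (bdeg F i q)}"
    and hc: "\<forall>z\<in>tensor_part F i {..c}. is_cycle F \<epsilon> i z \<longrightarrow> strand_diff F i (lincomb (rk F i) z h) = z"
    using Suc by blast
  let ?g = "\<lambda>q. lincomb (rk F i) (strand_diff F i (unit_vec q)) h"
  have "\<exists>w. w \<in> tensor_part F (Suc (Suc i)) {..f (bdeg F (Suc i) q)} \<and>
      strand_diff F (Suc i) w = unit_vec q - ?g q"
    if q: "q < rk F (Suc i)" "bdeg F (Suc i) q \<le> c" for q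
  proof -
    let ?b = "bdeg F (Suc i) q"
    have e: "unit_vec q \<in> tensor_part F (Suc i) {..?b}" "unit_vec q \<in> tensor_part F (Suc i) {..c}"
      using q by (auto intro: unit_vec_in_tensor_part)
    have de: "strand_diff F i (unit_vec q) \<in> tensor_part F i {..?b}"
      using e(1) by (rule strand_diff_in_tensor_part) auto
    then have de': "strand_diff F i (unit_vec q) \<in> tensor_part F i {..c}"
      by (rule tensor_part_mono[rotated]) (use q in auto)
    have "?g q \<in> tensor_part F (Suc i) {..f ?b}"
    proof (rule lincomb_in_tensor_part)
      fix p assume p: "p < rk F i" "strand_diff F i (unit_vec q) p \<noteq> 0"
      then have "bdeg F i p \<le> ?b" using de by (auto simp: tensor_part_def)
      then have "h p \<in> tensor_part F (Suc i) {..f (bdeg F i p)}" "f (bdeg F i p) \<le> f ?b"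
        using h p q mono by auto
      then show "h p \<in> tensor_part F (Suc i) {..f ?b}"
        by (auto intro: tensor_part_mono[rotated])
    qed
    moreover have "unit_vec q \<in> tensor_part F (Suc i) {..f ?b}"
      using e(1) inflate by (auto intro: tensor_part_mono[rotated])
    ultimately have "unit_vec q - ?g q \<in> tensor_part F (Suc i) {..f ?b}"
      by (rule tensor_part_diff[rotated])
    moreover have "strand_diff F i (?g q) = strand_diff F i (unit_vec q)"
      using hc de' is_cycle_strand_diff[OF F \<epsilon> e(2)] by blast
    then have "strand_diff F i (unit_vec q - ?g q) = 0"
      by (simp add: strand_diff_diff)
    ultimately show ?thesis using strand_exact[OF F] by metis
  qed
  then have "\<forall>q. \<exists>w. q < rk F (Suc i) \<and> bdeg F (Suc i) q \<le> c \<longrightarrow>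
      w \<in> tensor_part F (Suc (Suc i)) {..f (bdeg F (Suc i) q)} \<and>
      strand_diff F (Suc i) w = unit_vec q - ?g q" by blast
  from choice[OF this] obtain h' where h': "\<forall>q. q < rk F (Suc i) \<and> bdeg F (Suc i) q \<le> c \<longrightarrow>
      h' q \<in> tensor_part F (Suc (Suc i)) {..f (bdeg F (Suc i) q)} \<and>
      strand_diff F (Suc i) (h' q) = unit_vec q - ?g q" by blast
  have "strand_diff F (Suc i) (lincomb (rk F (Suc i)) z h') = z"
    if z: "z \<in> tensor_part F (Suc i) {..c}" "is_cycle F \<epsilon> (Suc i) z" for z
  proof -
    have zc: "z \<in> coord_vectors (rk F (Suc i))" using z(1) by (simp add: tensor_part_def)
    have "strand_diff F (Suc i) (lincomb (rk F (Suc i)) z h')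
        = lincomb (rk F (Suc i)) z (\<lambda>q. unit_vec q - ?g q)"
      unfolding strand_diff_lincomb using h' z(1) by (intro lincomb_cong) (auto simp: tensor_part_def)
    also have "\<dots> = z - lincomb (rk F (Suc i)) z ?g"
      using lincomb_unit_vec[OF zc] by (simp add: lincomb_diff)
    also have "lincomb (rk F (Suc i)) z ?g = lincomb (rk F i) (strand_diff F i z) h"
      by (simp only: lincomb_lincomb[symmetric] strand_diff_lincomb[symmetric] lincomb_unit_vec[OF zc])
    also have "strand_diff F i z = 0" using z(2) by (simp add: is_cycle_def)
    also have "lincomb (rk F i) 0 h = 0" by (simp add: lincomb_def fun_eq_iff)
    finally show ?thesis by simp
  qed
  with h' show ?case by blast
qed

section \<open>Homology modulo the variables\<close>

definition degree_part :: "(nat \<Rightarrow> int ^ 'n) \<Rightarrow> int ^ 'n \<Rightarrow> (nat \<Rightarrow> 'k) \<Rightarrow> nat \<Rightarrow> 'k::zero" where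
  "degree_part \<beta> b y = (\<lambda>q. if \<beta> q = b then y q else 0)"

lemma degree_part_in_tensor_part:
  "y \<in> coord_vectors (rk F i) \<Longrightarrow> degree_part (bdeg F i) b y \<in> tensor_part F i {b}"
  by (auto simp: degree_part_def tensor_part_def coord_vectors_def)

lemma lookup_zterm_0: "Poly_Mapping.lookup (zterm e c) 0 = (if e = 0 then c else 0)"
proof -
  have "0 = nat_exponent e \<longleftrightarrow> e = 0" if "0 \<le> e"
    using zdeg_eq_iff[of 0 e] that by (auto simp: zdeg_def vec_eq_iff nat_exponent_def)
  then show ?thesis by (auto simp: zterm_def lookup_single when_def)
qed

text \<open>
  A homogeneous entry is a scalar times a single monomial, which is constant only between basis elements
  of equal degree.
\<close>

lemma constant_coefficient:
  assumes F: "graded_resolution I F" and pq: "p < rk F i" "q < rk F (Suc i)"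
  shows "Poly_Mapping.lookup (dmat F i p q) 0 =
    (if bdeg F (Suc i) q = bdeg F i p
     then strand_matrix (bdeg F i) (bdeg F (Suc i)) (dmat F i) p q else 0)"
  by (subst homogeneous_matrix_entry[OF resolution_homogeneous[OF F] pq]) (simp add: lookup_zterm_0)

text \<open>
  An entry that \<^const>\<open>strand_diff\<close> has in excess of \<^const>\<open>tensor_diff\<close> leads from a basis vector of
  strictly larger degree; the condition on \<open>D\<close> excludes such basis vectors.
\<close>

lemma strand_diff_eq_tensor_diff:
  assumes F: "graded_resolution I F" and z: "z \<in> tensor_part F (Suc i) D"
    and max: "\<And>x. x \<in> D \<Longrightarrow> bdeg F i p \<le> x \<Longrightarrow> x = bdeg F i p"
  shows "strand_diff F i z p = tensor_diff F i z p"
proof (cases "p < rk F i")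
  case True
  have "strand_matrix (bdeg F i) (bdeg F (Suc i)) (dmat F i) p q * z q
      = Poly_Mapping.lookup (dmat F i p q) 0 * z q" if q: "q < rk F (Suc i)" for q
  proof (cases "z q = 0 \<or> bdeg F (Suc i) q = bdeg F i p")
    case True
    then show ?thesis using constant_coefficient[OF F \<open>p < rk F i\<close> q] by auto
  next
    case False
    then have "bdeg F (Suc i) q \<in> D" using z q by (auto simp: tensor_part_def)
    then have "\<not> bdeg F i p \<le> bdeg F (Suc i) q" using max False by blast
    then show ?thesis using constant_coefficient[OF F \<open>p < rk F i\<close> q] False strand_matrix_eq_0 by auto
  qed
  then have "(\<Sum>q<rk F (Suc i). strand_matrix (bdeg F i) (bdeg F (Suc i)) (dmat F i) p q * z q)
      = (\<Sum>q<rk F (Suc i). Poly_Mapping.lookup (dmat F i p q) 0 * z q)"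
    by (intro sum.cong) auto
  then show ?thesis by (simp only: strand_diff_def tensor_diff_def mat_app_def)
qed (simp add: strand_diff_def tensor_diff_def mat_app_def)

lemma tensor_diff_degree_part:
  assumes F: "graded_resolution I F"
  shows "tensor_diff F i (degree_part (bdeg F (Suc i)) b z)
    = degree_part (bdeg F i) b (tensor_diff F i z)"
proof
  fix p
  have "Poly_Mapping.lookup (dmat F i p q) 0 * degree_part (bdeg F (Suc i)) b z q
      = (if bdeg F i p = b then Poly_Mapping.lookup (dmat F i p q) 0 * z q else 0)"
    if "p < rk F i" "q < rk F (Suc i)" for q
    using constant_coefficient[OF F that] by (auto simp: degree_part_def)
  then show "tensor_diff F i (degree_part (bdeg F (Suc i)) b z) p
      = degree_part (bdeg F i) b (tensor_diff F i z) p"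
    by (auto simp: tensor_diff_def mat_app_def degree_part_def[of "bdeg F i"])
qed

text \<open>
  In the degree of a fixed coordinate \<open>p\<close>, reduction modulo the variables agrees with the strand
  differential on the part of \<open>v\<close> of that degree, and the strand differential squares to zero.
\<close>

lemma tensor_diff_tensor_diff:
  assumes F: "graded_resolution I F" and v: "v \<in> coord_vectors (rk F (Suc (Suc i)))"
  shows "tensor_diff F i (tensor_diff F (Suc i) v) = 0"
proof
  fix p
  let ?b = "bdeg F i p"
  let ?v = "degree_part (bdeg F (Suc (Suc i))) ?b v"
  have v': "?v \<in> tensor_part F (Suc (Suc i)) {?b}" using v by (rule degree_part_in_tensor_part)
  then have v'': "?v \<in> tensor_part F (Suc (Suc i)) {..?b}" by (rule tensor_part_mono[rotated]) auto
  have Dv: "strand_diff F (Suc i) ?v \<in> tensor_part F (Suc i) {..?b}"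
    using v'' by (rule strand_diff_in_tensor_part) auto
  have "degree_part (bdeg F (Suc i)) ?b (strand_diff F (Suc i) ?v)
      = degree_part (bdeg F (Suc i)) ?b (tensor_diff F (Suc i) ?v)"
    unfolding degree_part_def[of "bdeg F (Suc i)"] using strand_diff_eq_tensor_diff[OF F v'] by force
  also have "\<dots> = degree_part (bdeg F (Suc i)) ?b (tensor_diff F (Suc i) v)"
    unfolding tensor_diff_degree_part[OF F] by (auto simp: degree_part_def)
  finally have eq: "degree_part (bdeg F (Suc i)) ?b (strand_diff F (Suc i) ?v)
      = degree_part (bdeg F (Suc i)) ?b (tensor_diff F (Suc i) v)" .
  have "tensor_diff F i (tensor_diff F (Suc i) v) p
      = degree_part (bdeg F i) ?b (tensor_diff F i (tensor_diff F (Suc i) v)) p"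
    by (simp add: degree_part_def)
  also have "\<dots> = degree_part (bdeg F i) ?b (tensor_diff F i (strand_diff F (Suc i) ?v)) p"
    by (simp only: tensor_diff_degree_part[OF F, symmetric] eq)
  also have "\<dots> = tensor_diff F i (strand_diff F (Suc i) ?v) p"
    by (simp add: degree_part_def)
  also have "\<dots> = strand_diff F i (strand_diff F (Suc i) ?v) p"
    by (rule strand_diff_eq_tensor_diff[OF F Dv, symmetric]) auto
  also have "\<dots> = 0" using strand_diff_strand_diff[OF F v''] by simp
  finally show "tensor_diff F i (tensor_diff F (Suc i) v) p = 0 p" by simp
qed

lemma tor_boundaries_subset_tor_cycles:
  assumes "graded_resolution I F"
  shows "tor_boundaries F i \<subseteq> tor_cycles F i"
proof
  fix w assume "w \<in> tor_boundaries F i"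
  then obtain v where v: "w = tensor_diff F i v" "v \<in> coord_vectors (rk F (Suc i))"
    unfolding tor_boundaries_def by (rule imageE)
  have "w \<in> coord_vectors (rk F i)"
    unfolding v(1) tensor_diff_def by (rule mat_app_in_coord_vectors)
  then show "w \<in> tor_cycles F i"
    using tensor_diff_tensor_diff[OF assms] v by (cases i) (auto simp: tor_cycles_def)
qed

lemma tor_boundaries_add:
  assumes "v \<in> tor_boundaries F i" "w \<in> tor_boundaries F i"
  shows "v + w \<in> tor_boundaries F i"
proof -
  obtain v' w' where "v = tensor_diff F i v'" "v' \<in> coord_vectors (rk F (Suc i))"
      "w = tensor_diff F i w'" "w' \<in> coord_vectors (rk F (Suc i))"
    using assms unfolding tor_boundaries_def by blast
  then have "v + w = tensor_diff F i (v' + w')" "v' + w' \<in> coord_vectors (rk F (Suc i))"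
    by (simp_all only: tensor_diff_def mat_app_add coord_vectors_add)
  then show ?thesis unfolding tor_boundaries_def by (rule image_eqI)
qed

lemma zero_in_tor_boundaries: "0 \<in> tor_boundaries F i"
proof -
  have "tensor_diff F i 0 = 0" unfolding tensor_diff_def by (rule mat_app_zero)
  moreover have "0 \<in> coord_vectors (rk F (Suc i))" by (simp add: coord_vectors_def)
  ultimately show ?thesis unfolding tor_boundaries_def by (metis image_eqI)
qed

lemma tor_boundaries_scale:
  assumes "v \<in> tor_boundaries F i"
  shows "(\<lambda>q. c * v q) \<in> tor_boundaries F i"
proof -
  obtain v' where v': "v = tensor_diff F i v'" "v' \<in> coord_vectors (rk F (Suc i))"
    using assms unfolding tor_boundaries_def by blast
  then have "(\<lambda>q. c * v q) = tensor_diff F i (\<lambda>q. c * v' q)"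
    by (simp only: tensor_diff_def mat_app_scale)
  moreover have "(\<lambda>q. c * v' q) \<in> coord_vectors (rk F (Suc i))"
    using v'(2) by (simp add: coord_vectors_def)
  ultimately show ?thesis unfolding tor_boundaries_def by (rule image_eqI)
qed

text \<open>
  This is used to read the truncated difference in \<^const>\<open>tor_dim\<close> as the dimension of a quotient.
\<close>

lemma subspace_eq_of_kdim_le:
  assumes U: "coord.subspace U" "U \<subseteq> V" and V: "V \<subseteq> coord_vectors r" and "kdim V \<le> kdim U"
  shows "V \<subseteq> U"
proof -
  obtain G where G: "finite G" "G \<subseteq> U" "U \<subseteq> coord.span G" "coord.independent G" "card G = kdim U"
    using finite_basis_of_coord_vectors[of U r] U(2) V by blast
  obtain H where H: "G \<subseteq> H" "H \<subseteq> V" "coord.independent H" "V \<subseteq> coord.span H"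
    using coord.maximal_independent_subset_extend[of G V] G(2,4) U(2) by blast
  have "H \<subseteq> coord.span (unit_vec ` {..<r})"
    using H(2) V coord_vectors_subset_span by blast
  then have "finite H"
    using coord.independent_span_bound[OF _ H(3)] by blast
  moreover have "card H = kdim V"
    unfolding kdim_def using H(2-4) by (intro coord.basis_card_eq_dim)
  ultimately have "H = G" using H(1) G(5) assms(4) by (metis card_seteq)
  then show ?thesis using H(4) coord.span_minimal[OF G(2) U(1)] by blast
qed

lemma tor_dim_eq_0_iff:
  assumes F: "graded_resolution I F"
  shows "tor_dim F i D = 0 \<longleftrightarrow> tor_cycles F i \<inter> tensor_part F i D \<subseteq> tor_boundaries F i"
proof
  let ?Z = "tor_cycles F i \<inter> tensor_part F i D" and ?B = "tor_boundaries F i \<inter> tensor_part F i D"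
  have sub: "?B \<subseteq> ?Z" using tor_boundaries_subset_tor_cycles[OF F] by blast
  {
    assume "tor_dim F i D = 0"
    then have "kdim ?Z \<le> kdim ?B" by (simp add: tor_dim_def)
    moreover have "coord.subspace ?B"
    proof (rule coord.subspaceI)
      show "0 \<in> ?B" using zero_in_tor_boundaries zero_in_tensor_part by blast
      show "v + w \<in> ?B" if "v \<in> ?B" "w \<in> ?B" for v w
        using that tor_boundaries_add tensor_part_add by blast
      show "(\<lambda>q. c * w q) \<in> ?B" if "w \<in> ?B" for c w
        using that tor_boundaries_scale[of w F i c] by (auto simp: tensor_part_def coord_vectors_def)
    qed
    moreover have "?Z \<subseteq> coord_vectors (rk F i)" by (auto simp: tensor_part_def)
    ultimately show "?Z \<subseteq> tor_boundaries F i"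
      using subspace_eq_of_kdim_le[OF _ sub] by blast
  }
  assume "?Z \<subseteq> tor_boundaries F i"
  then have "?Z = ?B" using sub by blast
  then show "tor_dim F i D = 0" by (simp add: tor_dim_def)
qed

text \<open>
  The homology modulo the variables is the direct sum of its components in single degrees.
\<close>

lemma tor_vanishing_by_degrees:
  assumes F: "graded_resolution I F"
    and vanish: "\<And>b. b \<in> D \<Longrightarrow> tor_cycles F i \<inter> tensor_part F i {b} \<subseteq> tor_boundaries F i"
  shows "tor_cycles F i \<inter> tensor_part F i D \<subseteq> tor_boundaries F i"
proof
  fix z assume z: "z \<in> tor_cycles F i \<inter> tensor_part F i D"
  then have zc: "z \<in> coord_vectors (rk F i)" by (simp add: tensor_part_def)
  let ?E = "bdeg F i ` {..<rk F i}"
  have part: "degree_part (bdeg F i) b z \<in> tor_boundaries F i" for b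
  proof (cases "b \<in> D")
    case True
    have "degree_part (bdeg F i) b z \<in> tor_cycles F i"
    proof (cases i)
      case 0
      then show ?thesis
        using zc by (auto simp: tor_cycles_def coord_vectors_def degree_part_def)
    next
      case (Suc j)
      then have "tensor_diff F j z = 0" using z by (simp add: tor_cycles_def)
      then have "tensor_diff F j (degree_part (bdeg F i) b z) = 0"
        unfolding Suc tensor_diff_degree_part[OF F] by (auto simp: degree_part_def)
      then show ?thesis
        using zc Suc by (auto simp: tor_cycles_def coord_vectors_def degree_part_def)
    qed
    then show ?thesis using vanish[OF True] degree_part_in_tensor_part[OF zc] by blast
  next
    case False
    have "degree_part (bdeg F i) b z q = 0" for q
      using False z by (cases "q < rk F i") (auto simp: degree_part_def tensor_part_def coord_vectors_def)
    then have "degree_part (bdeg F i) b z = 0" by auto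
    then show ?thesis using zero_in_tor_boundaries by (simp only:)
  qed
  have "(\<Sum>b\<in>X. degree_part (bdeg F i) b z) \<in> tor_boundaries F i" for X
    by (induction X rule: infinite_finite_induct)
      (simp_all only: sum.infinite sum.empty sum.insert not_False_eq_True
        zero_in_tor_boundaries tor_boundaries_add part)
  moreover have "(\<Sum>b\<in>?E. degree_part (bdeg F i) b z) = z"
  proof
    fix q
    have "(\<Sum>b\<in>?E. degree_part (bdeg F i) b z q) = (\<Sum>b\<in>?E. if b = bdeg F i q then z q else 0)"
      by (intro sum.cong) (auto simp: degree_part_def)
    also have "\<dots> = z q" using zc by (cases "q < rk F i") (auto simp: coord_vectors_def)
    finally show "(\<Sum>b\<in>?E. degree_part (bdeg F i) b z) q = z q" by (simp only: sum_fun_apply)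
  qed
  ultimately show "z \<in> tor_boundaries F i" by metis
qed

section \<open>Vanishing of Tor in one degree\<close>

text \<open>
  If \<open>v\<close> is cut down to its part of degree \<open>c\<close>, its differential keeps the components of degree \<open>c\<close>, since
  nothing else in \<open>v\<close> contributes to them, and modulo the variables it has no other components.
\<close>

lemma tor_boundaryI:
  assumes F: "graded_resolution I F"
    and z: "z \<in> tensor_part F i {c}" and v: "v \<in> tensor_part F (Suc i) {..c}"
    and eq: "\<And>p. p < rk F i \<Longrightarrow> bdeg F i p = c \<Longrightarrow> strand_diff F i v p = z p"
  shows "z \<in> tor_boundaries F i"
proof -
  have "degree_part (bdeg F i) c (tensor_diff F i v) p = z p" for p
  proof (cases "p < rk F i \<and> bdeg F i p = c")
    case True
    then have "tensor_diff F i v p = strand_diff F i v p"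
      by (intro strand_diff_eq_tensor_diff[OF F v, symmetric]) auto
    then show ?thesis using True eq by (simp add: degree_part_def)
  next
    case False
    then have "z p = 0"
      using z by (cases "p < rk F i") (auto simp: tensor_part_def coord_vectors_def)
    then show ?thesis using False by (auto simp: degree_part_def tensor_diff_def mat_app_def)
  qed
  then have "z = tensor_diff F i (degree_part (bdeg F (Suc i)) c v)"
    unfolding tensor_diff_degree_part[OF F] by auto
  moreover have "degree_part (bdeg F (Suc i)) c v \<in> coord_vectors (rk F (Suc i))"
    using v by (auto simp: degree_part_def tensor_part_def coord_vectors_def)
  ultimately show ?thesis unfolding tor_boundaries_def by (rule image_eqI)
qed

text \<open>
  Here \<open>A\<close> is the set of degrees whose components of \<open>y\<close> are still to be removed. The component of \<open>y\<close>
  in a maximal degree \<open>b\<close> of \<open>A\<close> is a cycle modulo the variables, since no component of larger degree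
  contributes to the differential of \<open>y\<close> in degree \<open>b\<close>. As \<open>Tor\<^sub>i\<close> vanishes in degree \<open>b\<close>, this
  component is the degree-\<open>b\<close> part of the differential of a vector of degree \<open>b\<close>. Subtracting that
  differential clears the degree \<open>b\<close> and changes \<open>y\<close> otherwise only in smaller degrees.
\<close>

lemma push_to_lower_degrees:
  fixes F :: "('k::field, 'n::finite) free_complex"
  assumes F: "graded_resolution I F"
    and \<epsilon>: "\<And>z. z \<in> tensor_part F (Suc 0) {..c} \<Longrightarrow> (\<Sum>q<rk F 0. \<epsilon> q * strand_diff F 0 z q) = 0"
    and L: "L \<subseteq> {..<c}" "\<And>x y. x \<in> L \<Longrightarrow> y \<le> x \<Longrightarrow> y \<in> L"
    and "finite A" "A \<subseteq> {..<c} - L"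
    and "\<And>x q. x \<in> A \<Longrightarrow> q < rk F i \<Longrightarrow> bdeg F i q \<le> x \<Longrightarrow> bdeg F i q \<in> L \<union> A"
    and "\<And>b. b \<in> A \<Longrightarrow> tor_cycles F i \<inter> tensor_part F i {b} \<subseteq> tor_boundaries F i"
    and "y \<in> tensor_part F i (L \<union> A)" "is_cycle F \<epsilon> i y"
  shows "\<exists>w\<in>tensor_part F (Suc i) {..<c}. y - strand_diff F i w \<in> tensor_part F i L"
  using assms(5-)
proof (induction "card A" arbitrary: A y)
  case 0
  then have "y \<in> tensor_part F i L" by simp
  moreover have "strand_diff F i 0 = 0" by (simp only: strand_diff_def mat_app_zero)
  ultimately have "y - strand_diff F i 0 \<in> tensor_part F i L" by (simp only: diff_zero)
  then show ?case using zero_in_tensor_part by blast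
next
  case (Suc n)
  note down = Suc.prems(3) and y = Suc.prems(5)
  from Suc.hyps(2) have "A \<noteq> {}" by auto
  then obtain b where b: "b \<in> A" "\<And>x. x \<in> A \<Longrightarrow> b \<le> x \<Longrightarrow> x = b"
    using finite_has_maximal[OF Suc.prems(1)] by metis
  have bc: "b < c" "b \<notin> L" using b(1) Suc.prems(2) by auto
  let ?yb = "degree_part (bdeg F i) b y"
  \<comment> \<open>Degrees in \<open>L\<close> cannot lie above \<open>b\<close>, because \<open>L\<close> is closed downwards and omits \<open>b\<close>.\<close>
  have max: "x = b" if "x \<in> L \<union> A" "b \<le> x" for x
    using that b(2) L(2) bc(2) by blast
  have yc: "y \<in> coord_vectors (rk F i)" using y by (simp add: tensor_part_def)
  then have yb: "?yb \<in> tensor_part F i {b}" by (rule degree_part_in_tensor_part)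
  have "?yb \<in> tor_cycles F i"
  proof (cases i)
    case 0
    then show ?thesis using yb by (simp add: tor_cycles_def tensor_part_def)
  next
    case (Suc j)
    have "tensor_diff F j y p = 0" if "bdeg F j p = b" for p
    proof -
      have "tensor_diff F j y p = strand_diff F j y p"
        using strand_diff_eq_tensor_diff[OF F, of y j "L \<union> A" p] y max that Suc by simp
      then show ?thesis using Suc.prems(6) Suc by (simp add: is_cycle_def)
    qed
    then have "degree_part (bdeg F j) b (tensor_diff F j y) = 0"
      by (auto simp: degree_part_def)
    then have "tensor_diff F j ?yb = 0" unfolding Suc tensor_diff_degree_part[OF F] .
    then show ?thesis using yb Suc by (simp add: tor_cycles_def tensor_part_def)
  qed
  then have "?yb \<in> tor_boundaries F i" using Suc.prems(4)[OF b(1)] yb by blast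
  then obtain v where v: "?yb = tensor_diff F i v" "v \<in> coord_vectors (rk F (Suc i))"
    unfolding tor_boundaries_def by (rule imageE)
  let ?v = "degree_part (bdeg F (Suc i)) b v"
  have v': "?v \<in> tensor_part F (Suc i) {b}" using v(2) by (rule degree_part_in_tensor_part)
  have dv: "strand_diff F i ?v p = y p" if "bdeg F i p = b" for p
  proof -
    have "strand_diff F i ?v p = tensor_diff F i ?v p"
      by (rule strand_diff_eq_tensor_diff[OF F v']) (use that in auto)
    also have "\<dots> = y p"
      unfolding tensor_diff_degree_part[OF F] v(1)[symmetric] using that
      by (simp add: degree_part_def)
    finally show ?thesis .
  qed
  let ?y = "y - strand_diff F i ?v"
  have Dv: "strand_diff F i ?v \<in> tensor_part F i {..b}"
    using v' by (rule strand_diff_in_tensor_part) auto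
  have "\<exists>w\<in>tensor_part F (Suc i) {..<c}. ?y - strand_diff F i w \<in> tensor_part F i L"
  proof (rule Suc.hyps(1)[of "A - {b}"])
    show "n = card (A - {b})" using Suc.hyps(2) b(1) Suc.prems(1) by simp
    show "finite (A - {b})" "A - {b} \<subseteq> {..<c} - L" using Suc.prems(1,2) by auto
    show "bdeg F i q \<in> L \<union> (A - {b})" if "x \<in> A - {b}" "q < rk F i" "bdeg F i q \<le> x" for x q
      using down[of x q] that b by auto
    show "tor_cycles F i \<inter> tensor_part F i {b'} \<subseteq> tor_boundaries F i" if "b' \<in> A - {b}" for b'
      using Suc.prems(4) that by blast
    have "bdeg F i q \<in> L \<union> (A - {b})" if q: "q < rk F i" "?y q \<noteq> 0" for q
    proof -
      have "bdeg F i q \<noteq> b" using q(2) dv by auto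
      moreover have "y q \<noteq> 0 \<or> strand_diff F i ?v q \<noteq> 0" using q(2) by auto
      then have "bdeg F i q \<in> L \<union> A"
        using y Dv q(1) down[OF b(1) q(1)] by (auto simp: tensor_part_def)
      ultimately show ?thesis by blast
    qed
    then show "?y \<in> tensor_part F i (L \<union> (A - {b}))"
      using yc strand_diff_in_coord_vectors[of F i ?v] by (auto simp: tensor_part_def coord_vectors_def)
    have "?v \<in> tensor_part F (Suc i) {..c}" using v' bc(1) by (auto intro: tensor_part_mono[rotated])
    then show "is_cycle F \<epsilon> i ?y"
      by (intro is_cycle_diff Suc.prems(6) is_cycle_strand_diff[OF F \<epsilon>])
  qed
  then obtain w where w: "w \<in> tensor_part F (Suc i) {..<c}" "?y - strand_diff F i w \<in> tensor_part F i L"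
    by blast
  show ?case
  proof
    show "?v + w \<in> tensor_part F (Suc i) {..<c}"
      using v' bc(1) w(1) by (intro tensor_part_add) (auto intro: tensor_part_mono[rotated])
    have "y - strand_diff F i (?v + w) = ?y - strand_diff F i w"
      by (simp only: strand_diff_add diff_diff_add)
    then show "y - strand_diff F i (?v + w) \<in> tensor_part F i L" using w(2) by (simp only:)
  qed
qed

text \<open>
  A class of degree \<open>c\<close> in position \<open>i + 1\<close> vanishes as soon as the differential of a representative is
  also the differential of a vector of degrees \<open>< c\<close>. The contraction provides this vector for the
  components in the degrees \<open>b\<close> with \<open>f b < c\<close>, and vanishing in position \<open>i\<close> removes the others.
\<close>

lemma tor_vanishing_step:
  fixes F :: "('k::field, 'n::finite) free_complex" and f :: "int ^ 'n \<Rightarrow> int ^ 'n"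
  assumes F: "graded_resolution I F"
    and inflate: "\<And>b. b \<le> f b" and mono: "\<And>b b'. b \<le> b' \<Longrightarrow> f b \<le> f b'"
    and base: "\<And>q. q < rk F 0 \<Longrightarrow> bdeg F 0 q \<le> c \<Longrightarrow>
      \<exists>w\<in>tensor_part F (Suc 0) {..f (bdeg F 0 q)}. strand_diff F 0 w = unit_vec q - (\<lambda>p. \<epsilon> q * w\<^sub>0 p)"
    and \<epsilon>: "\<And>z. z \<in> tensor_part F (Suc 0) {..c} \<Longrightarrow> (\<Sum>q<rk F 0. \<epsilon> q * strand_diff F 0 z q) = 0"
    and vanish: "\<And>b. b < c \<Longrightarrow> \<not> f b < c \<Longrightarrow>
      tor_cycles F i \<inter> tensor_part F i {b} \<subseteq> tor_boundaries F i"
  shows "tor_cycles F (Suc i) \<inter> tensor_part F (Suc i) {c} \<subseteq> tor_boundaries F (Suc i)"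
proof
  fix z assume "z \<in> tor_cycles F (Suc i) \<inter> tensor_part F (Suc i) {c}"
  then have zt: "tensor_diff F i z = 0" and z: "z \<in> tensor_part F (Suc i) {c}"
    by (auto simp: tor_cycles_def)
  then have zc: "z \<in> tensor_part F (Suc i) {..c}" by (auto intro: tensor_part_mono[rotated])
  let ?y = "strand_diff F i z"
  have "?y \<in> tensor_part F i {..c}" using zc by (rule strand_diff_in_tensor_part) auto
  moreover have "?y p = 0" if "bdeg F i p = c" for p
    using strand_diff_eq_tensor_diff[OF F z, of p] zt that by simp
  ultimately have y: "?y \<in> tensor_part F i {..<c}"
    by (fastforce simp: tensor_part_def order_less_le)
  have cyc: "is_cycle F \<epsilon> i ?y" by (rule is_cycle_strand_diff[OF F \<epsilon> zc])
  define L where "L = {b. b < c \<and> f b < c}"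
  define A where "A = bdeg F i ` {..<rk F i} \<inter> ({..<c} - L)"
  have "\<exists>w\<in>tensor_part F (Suc i) {..<c}. ?y - strand_diff F i w \<in> tensor_part F i L"
  proof (rule push_to_lower_degrees[OF F \<epsilon>, where A = A])
    show "L \<subseteq> {..<c}" by (auto simp: L_def)
    show "y \<in> L" if "x \<in> L" "y \<le> x" for x y
      using that mono[of y x] by (auto simp: L_def)
    show "finite A" "A \<subseteq> {..<c} - L" by (auto simp: A_def)
    show "bdeg F i q \<in> L \<union> A" if "x \<in> A" "q < rk F i" "bdeg F i q \<le> x" for x q
      using that by (auto simp: A_def)
    show "tor_cycles F i \<inter> tensor_part F i {b} \<subseteq> tor_boundaries F i" if "b \<in> A" for b
      by (rule vanish) (use that in \<open>auto simp: A_def L_def\<close>)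
    show "?y \<in> tensor_part F i (L \<union> A)"
      using y by (auto simp: tensor_part_def A_def)
  qed (use cyc in auto)
  then obtain w1 where w1: "w1 \<in> tensor_part F (Suc i) {..<c}"
      "?y - strand_diff F i w1 \<in> tensor_part F i L" by blast
  have w1c: "w1 \<in> tensor_part F (Suc i) {..c}" using w1(1) by (auto intro: tensor_part_mono[rotated])
  let ?y' = "?y - strand_diff F i w1"
  obtain h where h: "\<forall>q<rk F i. bdeg F i q \<le> c \<longrightarrow> h q \<in> tensor_part F (Suc i) {..f (bdeg F i q)}"
    and hc: "\<forall>z\<in>tensor_part F i {..c}. is_cycle F \<epsilon> i z \<longrightarrow> strand_diff F i (lincomb (rk F i) z h) = z"
    using exists_contraction[where f = f and c = c and \<epsilon> = \<epsilon>  and i = i and w\<^sub>0 = w\<^sub>0,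
        OF F inflate mono base \<epsilon>] by blast
  let ?w2 = "lincomb (rk F i) ?y' h"
  have "?y' \<in> tensor_part F i {..c}"
    using w1(2) by (rule tensor_part_mono[rotated]) (auto simp: L_def)
  moreover have "is_cycle F \<epsilon> i ?y'"
    by (intro is_cycle_diff cyc is_cycle_strand_diff[OF F \<epsilon> w1c])
  ultimately have Dw2: "strand_diff F i ?w2 = ?y'" using hc by blast
  have w2: "?w2 \<in> tensor_part F (Suc i) {..<c}"
  proof (rule lincomb_in_tensor_part)
    fix q assume q: "q < rk F i" "?y' q \<noteq> 0"
    then have "bdeg F i q \<in> L" using w1(2) by (auto simp: tensor_part_def)
    then have "bdeg F i q < c" "f (bdeg F i q) < c" by (auto simp: L_def)
    then have "h q \<in> tensor_part F (Suc i) {..f (bdeg F i q)}" "{..f (bdeg F i q)} \<subseteq> {..<c}"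
      using h q(1) by auto
    then show "h q \<in> tensor_part F (Suc i) {..<c}" by (rule tensor_part_mono[rotated])
  qed
  let ?w = "w1 + ?w2"
  have w: "?w \<in> tensor_part F (Suc i) {..<c}" using w1(1) w2 by (rule tensor_part_add)
  then have "?w \<in> tensor_part F (Suc i) {..c}" by (rule tensor_part_mono[rotated]) auto
  then have zw: "z - ?w \<in> tensor_part F (Suc i) {..c}" by (rule tensor_part_diff[OF zc])
  have "strand_diff F i (z - ?w) = 0"
    by (simp only: strand_diff_diff strand_diff_add Dw2) simp
  then obtain v where v: "v \<in> tensor_part F (Suc (Suc i)) {..c}" "strand_diff F (Suc i) v = z - ?w"
    using strand_exact[OF F zw] by blast
  show "z \<in> tor_boundaries F (Suc i)"
  proof (rule tor_boundaryI[OF F z v(1)])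
    fix p assume p: "p < rk F (Suc i)" "bdeg F (Suc i) p = c"
    have "?w p = 0" using w p unfolding tensor_part_def by blast
    then show "strand_diff F (Suc i) v p = z p" by (simp add: v(2))
  qed
qed

text \<open>
  In position \<open>0\<close> the strand at \<open>b\<close> is exact, as \<open>S/I\<close> has no component in degree \<open>b\<close>.
\<close>

lemma tor_0_vanishing:
  assumes F: "graded_resolution I F" and I: "\<And>k. zterm b k \<in> I"
  shows "tor_cycles F 0 \<inter> tensor_part F 0 {b} \<subseteq> tor_boundaries F 0"
proof
  fix z assume "z \<in> tor_cycles F 0 \<inter> tensor_part F 0 {b}"
  then have z: "z \<in> tensor_part F 0 {b}" by blast
  then have "z \<in> tensor_part F 0 {..b}" by (rule tensor_part_mono[rotated]) auto
  then obtain w where w: "w \<in> tensor_part F (Suc 0) {..b}" "strand_diff F 0 w = z"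
    using strand_exact_0[OF F _ I] by blast
  then show "z \<in> tor_boundaries F 0" using tor_boundaryI[OF F z] by simp
qed

section \<open>Quotients by monomial ideals\<close>

lemma zterm_in_ideal:
  fixes u :: "nat \<Rightarrow> ('k::field, 'n::finite) mpoly"
  assumes "\<And>l. l \<in> {1..r} \<Longrightarrow> u l = xmonom (\<alpha> l)"
    and l: "l \<in> {1..r}" "zdeg (\<alpha> l) \<le> b"
  shows "zterm b k \<in> ideal_of (u ` {1..r})"
proof -
  interpret S: module "(*) :: ('k, 'n) mpoly \<Rightarrow> _" by (rule module_mult)
  have "zterm (b - zdeg (\<alpha> l)) k * u l \<in> S.span (u ` {1..r})"
    using l(1) by (intro S.span_scale S.span_base) auto
  moreover have "zterm (b - zdeg (\<alpha> l)) k * u l = zterm b k"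
    using zterm_mult_zterm[of "b - zdeg (\<alpha> l)" "zdeg (\<alpha> l)" k 1] l assms(1)[OF l(1)]
    by (simp add: xmonom_eq_zterm vec_diff_nonneg_iff zdeg_nonneg)
  ultimately show ?thesis by (simp add: ideal_of_def)
qed

lemma zcoeff_ideal_eq_0:
  fixes u :: "nat \<Rightarrow> ('k::field, 'n::finite) mpoly"
  assumes u: "\<And>l. l \<in> {1..r} \<Longrightarrow> u l = xmonom (\<alpha> l)"
    and b: "\<And>l. l \<in> {1..r} \<Longrightarrow> \<not> zdeg (\<alpha> l) \<le> b"
    and g: "g \<in> ideal_of (u ` {1..r})"
  shows "zcoeff b g = 0"
proof -
  obtain w where "g = (\<Sum>q<r. u (Suc q) * w q)"
    using g unfolding ideal_of_eq_combinations by blast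
  moreover have "zcoeff b (u (Suc q) * w q) = 0" if "q < r" for q
    using that u[of "Suc q"] b[of "Suc q"]
    by (simp add: xmonom_eq_zterm zcoeff_zterm_mult) (simp add: zcoeff_def vec_diff_nonneg_iff)
  ultimately show ?thesis by (simp add: zcoeff_sum)
qed

text \<open>
  Below \<open>c\<close> the resolution of \<open>S/I\<close> looks like one of \<open>S\<close>. Hence the strands have a contraction
  preserving degrees, once the augmentation in position \<open>0\<close> is split by an element \<open>w\<^sub>0\<close> of degree \<open>0\<close>
  over \<open>1 \<in> S\<close>.
\<close>

lemma tor_vanishing_outside_ideal:
  fixes F :: "('k::field, 'n::finite) free_complex"
  assumes F: "graded_resolution I F" and "0 \<in> I"
    and I: "\<And>g b. g \<in> I \<Longrightarrow> b \<le> c \<Longrightarrow> zcoeff b g = 0"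
  shows "tor_cycles F (Suc i) \<inter> tensor_part F (Suc i) {c} \<subseteq> tor_boundaries F (Suc i)"
proof -
  \<comment> \<open>If \<open>0 \<le> c\<close> fails, the augmentation vanishes on all degrees below \<open>c\<close> and any \<open>w\<^sub>0\<close> will do.\<close>
  have "\<exists>w. 0 \<le> c \<longrightarrow> w \<in> tensor_part F 0 {..0} \<and> (\<Sum>q<rk F 0. strand_aug F q * w q) = 1"
    using strand_aug_surj[OF F] I by metis
  then obtain w\<^sub>0 where w\<^sub>0: "0 \<le> c \<Longrightarrow> w\<^sub>0 \<in> tensor_part F 0 {..0}"
      "0 \<le> c \<Longrightarrow> (\<Sum>q<rk F 0. strand_aug F q * w\<^sub>0 q) = 1" by blast
  show ?thesis
  proof (rule tor_vanishing_step[where f = "\<lambda>b. b" and \<epsilon> = "strand_aug F" and w\<^sub>0 = w\<^sub>0, OF F])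
    fix q assume q: "q < rk F 0" "bdeg F 0 q \<le> c"
    let ?b = "bdeg F 0 q" and ?z = "unit_vec q - (\<lambda>p. strand_aug F q * w\<^sub>0 p)"
    have e: "unit_vec q \<in> tensor_part F 0 {..?b}" using q(1) by (simp add: unit_vec_in_tensor_part)
    have \<epsilon>e: "(\<Sum>p<rk F 0. strand_aug F p * unit_vec q p) = strand_aug F q"
      using q(1) by (simp add: unit_vec_def if_distrib cong: if_cong)
    have "?z \<in> tensor_part F 0 {..?b} \<and> (\<Sum>p<rk F 0. strand_aug F p * ?z p) = 0"
    proof (cases "strand_aug F q = 0")
      case True
      then have "?z = unit_vec q" by (simp add: fun_eq_iff)
      then show ?thesis using e \<epsilon>e True by (simp only:)
    next
      case False
      then have "0 \<le> ?b" by (simp add: strand_aug_def zcoeff_def split: if_splits)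
      then have "0 \<le> c" using q(2) by (rule order_trans)
      have "w\<^sub>0 \<in> tensor_part F 0 {..?b}"
        using w\<^sub>0(1)[OF \<open>0 \<le> c\<close>] by (rule tensor_part_mono[rotated]) (use \<open>0 \<le> ?b\<close> in auto)
      then have "(\<lambda>p. strand_aug F q * w\<^sub>0 p) \<in> tensor_part F 0 {..?b}"
        by (auto simp: tensor_part_def coord_vectors_def)
      then have "?z \<in> tensor_part F 0 {..?b}" by (rule tensor_part_diff[OF e])
      moreover have "(\<Sum>p<rk F 0. strand_aug F p * ?z p)
          = strand_aug F q - strand_aug F q * (\<Sum>p<rk F 0. strand_aug F p * w\<^sub>0 p)"
        using \<epsilon>e by (simp add: right_diff_distrib sum_subtractf sum_distrib_left mult.left_commute)
      ultimately show ?thesis using w\<^sub>0(2)[OF \<open>0 \<le> c\<close>] by simp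
    qed
    then show "\<exists>w\<in>tensor_part F (Suc 0) {..?b}. strand_diff F 0 w = ?z"
      using strand_exact_0[OF F, of ?z ?b] \<open>0 \<in> I\<close> by (metis zterm_zero)
  next
    fix z assume "z \<in> tensor_part F (Suc 0) {..c}"
    then show "(\<Sum>q<rk F 0. strand_aug F q * strand_diff F 0 z q) = 0"
      using strand_aug_strand_diff[OF F] I by blast
  qed auto
qed

text \<open>
  The degrees \<open>b < a + \<alpha>\<close> in which the contraction does not stay below \<open>a + \<alpha>\<close> are those whose
  join with \<open>\<alpha>\<close> is \<open>a + \<alpha>\<close>. In a coordinate where \<open>a\<close> is positive, \<open>b\<close> then agrees with \<open>a + \<alpha>\<close>; in
  a coordinate where \<open>a\<close> is \<open>0\<close>, the comparison with \<open>a\<close> follows from \<open>b \<ge> 0\<close>. A chosen resolution may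
  contain basis elements of negative degrees, hence the separate hypothesis on \<open>b\<close> that are not
  nonnegative.
\<close>

lemma tor_vanishing_above_generator:
  fixes F :: "('k::field, 'n::finite) free_complex"
  assumes F: "graded_resolution I F" and "0 \<le> a"
    and \<alpha>: "0 \<le> \<alpha>" and I: "\<And>b k. \<alpha> \<le> b \<Longrightarrow> zterm b k \<in> I"
    and nonneg: "\<And>b. \<not> 0 \<le> b \<Longrightarrow> tor_cycles F i \<inter> tensor_part F i {b} \<subseteq> tor_boundaries F i"
    and vanish: "\<And>b. a \<le> b \<Longrightarrow> b < a + \<alpha> \<Longrightarrow>
      tor_cycles F i \<inter> tensor_part F i {b} \<subseteq> tor_boundaries F i"
  shows "tor_cycles F (Suc i) \<inter> tensor_part F (Suc i) {a + \<alpha>} \<subseteq> tor_boundaries F (Suc i)"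
proof -
  define f where "f b = (\<chi> j. max (b $ j) (\<alpha> $ j))" for b :: "int ^ 'n"
  have \<alpha>f: "\<alpha> \<le> f b" for b by (simp add: f_def less_eq_vec_def)
  show ?thesis
  proof (rule tor_vanishing_step[where f = f and \<epsilon> = "\<lambda>_. 0" and w\<^sub>0 = 0, OF F])
    show ff: "b \<le> f b" for b by (simp add: f_def less_eq_vec_def)
    show "f b \<le> f b'" if "b \<le> b'" for b b'
      using that by (auto simp: f_def less_eq_vec_def max.coboundedI1)
    fix q assume q: "q < rk F 0"
    have "unit_vec q \<in> tensor_part F 0 {..f (bdeg F 0 q)}"
      using q ff by (simp add: unit_vec_in_tensor_part)
    from strand_exact_0[OF F this I[OF \<alpha>f]]
    have "\<exists>w\<in>tensor_part F (Suc 0) {..f (bdeg F 0 q)}. strand_diff F 0 w = unit_vec q" by blast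
    moreover have "unit_vec q - (\<lambda>p. 0 * 0 p) = (unit_vec q :: nat \<Rightarrow> 'k)" by auto
    ultimately show "\<exists>w\<in>tensor_part F (Suc 0) {..f (bdeg F 0 q)}.
        strand_diff F 0 w = unit_vec q - (\<lambda>p. 0 * 0 p)" by (simp only:)
  next
    fix b assume b: "b < a + \<alpha>" "\<not> f b < a + \<alpha>"
    have "\<alpha> \<le> a + \<alpha>" using \<open>0 \<le> a\<close> by (simp add: less_eq_vec_def)
    then have "f b \<le> a + \<alpha>" using b(1) by (auto simp: f_def less_eq_vec_def dest!: order_less_imp_le)
    then have fb: "f b = a + \<alpha>" using b(2) by (simp add: order_less_le)
    show "tor_cycles F i \<inter> tensor_part F i {b} \<subseteq> tor_boundaries F i"
    proof (cases "0 \<le> b")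
      case True
      have "a $ j \<le> b $ j" for j
      proof -
        have "max (b $ j) (\<alpha> $ j) = a $ j + \<alpha> $ j"
          using arg_cong[OF fb, of "\<lambda>x. x $ j"] by (simp add: f_def)
        moreover have "0 \<le> b $ j" "0 \<le> \<alpha> $ j" using True \<alpha> by (simp_all add: less_eq_vec_def)
        ultimately show ?thesis by linarith
      qed
      then have "a \<le> b" by (simp add: less_eq_vec_def)
      then show ?thesis using vanish b(1) by blast
    qed (rule nonneg)
  qed simp_all
qed

lemma tdeg_mono: "a \<le> b \<Longrightarrow> tdeg a \<le> tdeg b"
  by (simp add: tdeg_def less_eq_vec_def sum_mono)

lemma tdeg_strict_mono:
  assumes "a < b"
  shows "tdeg a < tdeg b"
proof -
  have le: "a $ j \<le> b $ j" for j using assms by (auto simp: less_eq_vec_def dest: order_less_imp_le)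
  moreover have "a \<noteq> b" using assms by simp
  then have "\<exists>j. a $ j \<noteq> b $ j" by (simp add: vec_eq_iff)
  then obtain j where "a $ j < b $ j" using le by (metis order_less_le)
  ultimately show ?thesis unfolding tdeg_def by (intro sum_strict_mono_ex1) auto
qed

lemma tdeg_diff: "tdeg (a - b) = tdeg a - tdeg b"
  by (simp add: tdeg_def sum_subtractf)

theorem theorem6p2:
  fixes u :: "nat \<Rightarrow> ('k::field, 'n::finite) mpoly"
    and \<alpha> :: "nat \<Rightarrow> nat ^ 'n"
    and r :: nat
    and I :: "('k, 'n) mpoly set"
    and d :: int
  assumes "r \<ge> 1"
    and "\<And>l. l \<in> {1..r} \<Longrightarrow> u l = xmonom (\<alpha> l)"
    and "I = ideal_of (u ` {1..r})"
    and "d = Max ((\<lambda>l. tdeg (zdeg (\<alpha> l))) ` {1..r})"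
  shows "(\<forall>l\<in>{1..r}. \<forall>i::nat. \<forall>a::int ^ 'n. 0 \<le> a \<longrightarrow>
            (\<forall>b. a \<le> b \<and> b < a + zdeg (\<alpha> l) \<longrightarrow> multigraded_betti I i b = 0) \<longrightarrow>
            multigraded_betti I (i + 1) (a + zdeg (\<alpha> l)) = 0) \<and>
         (\<forall>(i::nat) (j::int).
            (\<forall>k\<in>{j..j + d - 1}. graded_betti I i k = 0) \<longrightarrow>
            graded_betti I (i + 1) (j + d) = 0)"
proof -
  define F where "F = tor_resolution I"
  have F: "graded_resolution I F"
    unfolding F_def tor_resolution_def assms(3)
    by (rule someI_ex[OF exists_graded_resolution[OF assms(2)]])
  let ?van = "\<lambda>i D. tor_cycles F i \<inter> tensor_part F i D \<subseteq> tor_boundaries F i"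
  have betti: "multigraded_betti I i b = 0 \<longleftrightarrow> ?van i {b}"
      "graded_betti I i k = 0 \<longleftrightarrow> ?van i {b. tdeg b = k}" for i b k
    by (simp_all add: multigraded_betti_def graded_betti_def F_def[symmetric] tor_dim_eq_0_iff[OF F])
  have I: "zterm b k \<in> I" if "l \<in> {1..r}" "zdeg (\<alpha> l) \<le> b" for l b k
    unfolding assms(3)
    by (rule zterm_in_ideal[where u = u and r = r and \<alpha> = \<alpha>]) (use assms(2) that in blast)+
  have "0 \<in> I" unfolding assms(3) ideal_of_def by (rule module.span_zero[OF module_mult])
  have outside: "?van (Suc i) {c}" if "\<And>l. l \<in> {1..r} \<Longrightarrow> \<not> zdeg (\<alpha> l) \<le> c" for i c
  proof (rule tor_vanishing_outside_ideal[OF F \<open>0 \<in> I\<close>])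
    fix g b assume "g \<in> I" "b \<le> c"
    then show "zcoeff b g = 0"
      unfolding assms(3) using that order_trans
      by (intro zcoeff_ideal_eq_0[where u = u and r = r and \<alpha> = \<alpha> and b = b and g = g] assms(2)) blast+
  qed
  have nonneg: "?van i {b}" if "\<not> 0 \<le> b" for i b
  proof (cases i)
    case 0
    have "zterm b k \<in> I" for k using \<open>0 \<in> I\<close> that by (simp add: zterm_def)
    then show ?thesis using tor_0_vanishing[OF F] 0 by blast
  next
    case (Suc j)
    have "\<not> zdeg (\<alpha> l) \<le> b" for l using that zdeg_nonneg order_trans by blast
    then show ?thesis using outside Suc by blast
  qed
  have main: "?van (Suc i) {a + zdeg (\<alpha> l)}"
    if "l \<in> {1..r}" "0 \<le> a" "\<And>b. a \<le> b \<Longrightarrow> b < a + zdeg (\<alpha> l) \<Longrightarrow> ?van i {b}" for l i a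
    by (rule tor_vanishing_above_generator[OF F \<open>0 \<le> a\<close> zdeg_nonneg I[OF that(1)] nonneg that(3)])
  have "?van (Suc i) {b. tdeg b = j + d}"
    if van: "\<And>k. k \<in> {j..j + d - 1} \<Longrightarrow> ?van i {b. tdeg b = k}" for i j
  proof (rule tor_vanishing_by_degrees[OF F])
    fix c :: "int ^ 'n" assume "c \<in> {b. tdeg b = j + d}"
    then have c: "tdeg c = j + d" by simp
    show "?van (Suc i) {c}"
    proof (cases "\<exists>l\<in>{1..r}. zdeg (\<alpha> l) \<le> c")
      case True
      then obtain l where l: "l \<in> {1..r}" "zdeg (\<alpha> l) \<le> c" by blast
      have "tdeg (zdeg (\<alpha> l)) \<le> d" unfolding assms(4) using l(1) by (intro Max_ge) auto
      then have tdeg: "j \<le> tdeg (c - zdeg (\<alpha> l))" by (simp add: tdeg_diff c)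
      have "?van i {b}" if "c - zdeg (\<alpha> l) \<le> b" "b < c - zdeg (\<alpha> l) + zdeg (\<alpha> l)" for b
      proof -
        have "b < c" using that(2) by simp
        then have "tdeg b \<in> {j..j + d - 1}"
          using tdeg tdeg_mono[OF that(1)] tdeg_strict_mono[of b c] c by simp
        then show ?thesis using van tensor_part_mono[of "{b}" "{b'. tdeg b' = tdeg b}"] by blast
      qed
      then show ?thesis using main[of l "c - zdeg (\<alpha> l)" i] l by (simp add: vec_diff_nonneg_iff)
    qed (use outside in blast)
  qed
  then show ?thesis using main by (simp add: betti)
qed

end
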